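(* The family $(\mathcal K_\delta)_{\delta\in[0,\delta_0]}$ is uniformly bounded in $\mathcal L(L^p(D;\mathbb R^q);L^p(D;\mathbb R^q))$ for all $p\in[1,\infty]$. Moreover, for every $p\in[1,\infty)$ and every $f\in L^p(D;\mathbb R^q)$, $\|\mathcal K_\delta f-f\|_{L^p(D;\mathbb R^q)}\to 0$ as $\delta\to 0$.
   Context: $D\subset\mathbb R^d$ is an open, bounded, connected, strongly Lipschitz set (its boundary is locally, up to affine change of coordinates, the graph of a Lipschitz function with $D$ on one side). $B(\mathbf x,\rho)$ denotes the open Euclidean ball; $\|\cdot\|_{\ell^2}$ is the Euclidean norm (and the induced norm on matrices and multilinear maps). Let $\mathbf j\in C^\infty(\mathbb R^d;\mathbb R^d)$ be a fixed vector field with $\|\mathbf j\|_{\ell^2}=1$ on $\partial D$ that is globally transversal: there is $\gamma>0$ with $\mathbf n\cdot\mathbf j\ge\gamma$ a.e. on $\partial D$, $\mathbf n$ being the outward unit normal. Set $\boldsymbol\varphi_\delta(\mathbf x)=\mathbf x-\delta\,\mathbf j(\mathbf x)$, and let $r>0$ be fixed such that $\boldsymbol\varphi_\delta(D)+B(\mathbf 0,\delta r)\subset D$ for all $\delta\in[0,1]$ (for $\delta=0$ the ball is understood as $\{\mathbf 0\}$). Let $\mathbb J_\delta(\mathbf x)$ be the Jacobian matrix of $\boldsymbol\varphi_\delta$ at $\mathbf x$, and let $\delta_0\in(0,1]$ be such that $\|\mathbb J_\delta(\mathbf x)-\mathbb I\|_{\ell^2}\le\frac12$, $\|\mathbb J_\delta^{-1}(\mathbf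 x)\|_{\ell^2}\le 2$ and $|\det(\mathbb J_\delta^{-1}(\mathbf x))|\le 2^d$ for all $\delta\in[0,\delta_0]$, $\mathbf x\in D$. The kernel is $\rho(\mathbf y)=\eta\exp\left(-\frac{1}{1-\|\mathbf y\|_{\ell^2}^2}\right)$ if $\|\mathbf y\|_{\ell^2}<1$, $\rho(\mathbf y)=0$ otherwise, with $\eta$ such that $\int_{\mathbb R^d}\rho=1$. Let $q\ge1$ be an integer and, for $\delta\in[0,1]$, let $\mathbb A_\delta:D\to\mathbb R^{q\times q}$ be a smooth field such that for all $l\in\mathbb N$ there is $c$ (independent of $\delta$) with $\sup_{\mathbf x\in D}\|D^l(\mathbb A_\delta(\mathbf x)-\mathbb I)\|_{\ell^2}\le c\,\delta$. For $f\in L^1(D;\mathbb R)$ and $g=(g_1,\dots,g_q)^{\mathsf T}\in L^1(D;\mathbb R^q)$ define, for $\mathbf x\in D$, $$(\mathcal K_\delta^{\mathrm g}f)(\mathbf x)=\int_{B(\mathbf 0,1)}\rho(\mathbf y)f(\boldsymbol\varphi_\delta(\mathbf x)+\delta r\mathbf y)\,d\mathbf y,\qquad (\mathcal K_\delta g)(\mathbf x)=\mathbb A_\delta(\mathbf x)\,(\mathcal K_\delta^{\mathrm g}g_1(\mathbf x),\dots,\mathcal K_\delta^{\mathrm g}g_q(\mathbf x))^{\mathsf T}.$$ *)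

theory Defs
  imports "HOL-Analysis.Analysis" "HOL-Probability.Essential_Supremum"
begin

text \<open>In finite dimension this is the usual class \<open>C\<^sup>k(S)\<close> for open \<open>S\<close>.\<close>

fun Ck_on :: "nat \<Rightarrow> 'a::real_normed_vector set \<Rightarrow> ('a \<Rightarrow> 'b::real_normed_vector) \<Rightarrow> bool" where
  "Ck_on 0 S F \<longleftrightarrow> continuous_on S F"
| "Ck_on (Suc k) S F \<longleftrightarrow> (\<forall>x\<in>S. F differentiable (at x)) \<and>
     (\<forall>h. Ck_on k S (\<lambda>x. frechet_derivative F (at x) h))"

definition smooth_on :: "'a::real_normed_vector set \<Rightarrow> ('a \<Rightarrow> 'b::real_normed_vector) \<Rightarrow> bool" where
  "smooth_on S F \<longleftrightarrow> (\<forall>k. Ck_on k S F)"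

text \<open>For smooth \<open>F\<close>, \<open>iter_deriv [h\<^sub>1, \<dots>, h\<^sub>l] F x\<close> is the value of the symmetric multilinear
  map \<open>D\<^sup>l F(x)\<close> at \<open>(h\<^sub>1, \<dots>, h\<^sub>l)\<close>.\<close>

primrec iter_deriv :: "'a::real_normed_vector list \<Rightarrow> ('a \<Rightarrow> 'b::real_normed_vector) \<Rightarrow> 'a \<Rightarrow> 'b" where
  "iter_deriv [] F = F"
| "iter_deriv (h # hs) F = iter_deriv hs (\<lambda>x. frechet_derivative F (at x) h)"

text \<open>The matrix norm induced by the Euclidean norm; the library's \<open>norm\<close> on matrices is the
  Frobenius norm.\<close>

definition matrix_opnorm :: "real^'n^'m \<Rightarrow> real" where
  "matrix_opnorm M = onorm (\<lambda>v. M *v v)"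

definition matrix_deriv_norm :: "nat \<Rightarrow> ('a::real_normed_vector \<Rightarrow> real^'n^'m) \<Rightarrow> 'a \<Rightarrow> real" where
  "matrix_deriv_norm l F x =
     (SUP hs\<in>{hs. length hs = l \<and> (\<forall>h\<in>set hs. norm h \<le> 1)}. matrix_opnorm (iter_deriv hs F x))"

text \<open>In the affine coordinates \<open>y = T *v x + b\<close>, the set \<open>D\<close> is, within the open set \<open>U\<close>, the part
  strictly below the graph \<open>y\<^sub>k = \<psi>(y)\<close>. The Lipschitz function \<open>\<psi>\<close> of \<open>d - 1\<close> variables is encoded
  as a function on \<open>\<real>\<^sup>d\<close> that does not depend on the \<open>k\<close>-th coordinate.\<close>

definition lipschitz_chart ::
  "(real^'d) set \<Rightarrow> (real^'d) set \<Rightarrow> real^'d^'d \<Rightarrow> real^'d \<Rightarrow> 'd \<Rightarrow> (real^'d \<Rightarrow> real) \<Rightarrow> bool" where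
  "lipschitz_chart D U T b k \<psi> \<longleftrightarrow>
     open U \<and> invertible T \<and> (\<exists>L. L-lipschitz_on UNIV \<psi>) \<and>
     (\<forall>y y'. (\<forall>i. i \<noteq> k \<longrightarrow> y $ i = y' $ i) \<longrightarrow> \<psi> y = \<psi> y') \<and>
     D \<inter> U = {x\<in>U. (T *v x + b) $ k < \<psi> (T *v x + b)} \<and>
     frontier D \<inter> U = {x\<in>U. (T *v x + b) $ k = \<psi> (T *v x + b)}"

definition strongly_lipschitz :: "(real^'d) set \<Rightarrow> bool" where
  "strongly_lipschitz D \<longleftrightarrow> (\<forall>z\<in>frontier D. \<exists>U T b k \<psi>. z \<in> U \<and> lipschitz_chart D U T b k \<psi>)"

text \<open>Within a chart, \<open>D\<close> is the sublevel set \<open>{g < 0}\<close> of \<open>g(x) = y\<^sub>k - \<psi>(y)\<close>, \<open>y = T *v x + b\<close>, so the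
  outward unit normal at a boundary point where \<open>g\<close> is differentiable is the normalised gradient
  of \<open>g\<close> (which is nonzero, as \<open>g\<close> has slope 1 in the direction of the \<open>k\<close>-th chart axis).\<close>

definition outward_unit_normal :: "(real^'d) set \<Rightarrow> real^'d \<Rightarrow> real^'d \<Rightarrow> bool" where
  "outward_unit_normal D x n \<longleftrightarrow> x \<in> frontier D \<and>
     (\<exists>U T b k \<psi> G. x \<in> U \<and> lipschitz_chart D U T b k \<psi> \<and>
        (GDERIV (\<lambda>z. (T *v z + b) $ k - \<psi> (T *v z + b)) x :> G) \<and> n = sgn G)"

text \<open>The \<open>s\<close>-dimensional Hausdorff (outer) measure, up to the usual normalising factor, which
  is immaterial for null sets. The empty set is treated separately because \<open>0 ^ 0 = 1\<close>.\<close>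

definition hausdorff_measure :: "nat \<Rightarrow> 'a::metric_space set \<Rightarrow> ennreal" where
  "hausdorff_measure s S =
     (SUP \<epsilon>\<in>{0<..}.
        INF V\<in>{V :: nat \<Rightarrow> 'a set. S \<subseteq> (\<Union>i. V i) \<and> (\<forall>i. bounded (V i) \<and> diameter (V i) \<le> \<epsilon>)}.
          \<Sum>i. if V i = {} then 0 else ennreal (diameter (V i) ^ s))"

definition AE_boundary :: "(real^'d) set \<Rightarrow> (real^'d \<Rightarrow> bool) \<Rightarrow> bool" where
  "AE_boundary D P \<longleftrightarrow> hausdorff_measure (CARD('d) - 1) {x\<in>frontier D. \<not> P x} = 0"

definition globally_transversal :: "(real^'d) set \<Rightarrow> (real^'d \<Rightarrow> real^'d) \<Rightarrow> bool" where
  "globally_transversal D j \<longleftrightarrow>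
     (\<exists>\<gamma>>0. AE_boundary D (\<lambda>x. \<exists>n. outward_unit_normal D x n \<and> n \<bullet> j x \<ge> \<gamma>))"

text \<open>Elements of \<open>L\<^sup>p\<close> are represented by functions; equality in \<open>L\<^sup>p\<close> is equality almost
  everywhere.\<close>

definition Lp_norm :: "ennreal \<Rightarrow> 'a measure \<Rightarrow> ('a \<Rightarrow> 'b::real_normed_vector) \<Rightarrow> ennreal" where
  "Lp_norm p M f =
     (if p = \<infinity> then esssup M (\<lambda>x. ennreal (norm (f x)))
      else let I = (\<integral>\<^sup>+ x. ennreal (norm (f x) powr enn2real p) \<partial>M)
           in if I = \<infinity> then \<infinity> else ennreal (enn2real I powr (1 / enn2real p)))"

definition Lp_space :: "ennreal \<Rightarrow> 'a measure \<Rightarrow> ('a \<Rightarrow> 'b::real_normed_vector) set" where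
  "Lp_space p M = {f \<in> borel_measurable M. Lp_norm p M f < \<infinity>}"

definition linear_on_Lp ::
  "ennreal \<Rightarrow> 'a measure \<Rightarrow> (('a \<Rightarrow> 'b::real_normed_vector) \<Rightarrow> 'a \<Rightarrow> 'b) \<Rightarrow> bool" where
  "linear_on_Lp p M T \<longleftrightarrow>
     (\<forall>f\<in>Lp_space p M. T f \<in> Lp_space p M) \<and>
     (\<forall>f\<in>Lp_space p M. \<forall>g\<in>Lp_space p M. (AE x in M. f x = g x) \<longrightarrow> (AE x in M. T f x = T g x)) \<and>
     (\<forall>f\<in>Lp_space p M. \<forall>g\<in>Lp_space p M. AE x in M. T (\<lambda>z. f z + g z) x = T f x + T g x) \<and>
     (\<forall>f\<in>Lp_space p M. \<forall>a. AE x in M. T (\<lambda>z. a *\<^sub>R f z) x = a *\<^sub>R T f x)"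

definition Lp_opnorm ::
  "ennreal \<Rightarrow> 'a measure \<Rightarrow> (('a \<Rightarrow> 'b::real_normed_vector) \<Rightarrow> 'a \<Rightarrow> 'b) \<Rightarrow> ennreal" where
  "Lp_opnorm p M T = (SUP f\<in>{f\<in>Lp_space p M. Lp_norm p M f \<le> 1}. Lp_norm p M (T f))"

definition unif_bounded_on_Lp ::
  "ennreal \<Rightarrow> 'a measure \<Rightarrow> 'i set \<Rightarrow> ('i \<Rightarrow> ('a \<Rightarrow> 'b::real_normed_vector) \<Rightarrow> 'a \<Rightarrow> 'b) \<Rightarrow> bool" where
  "unif_bounded_on_Lp p M I T \<longleftrightarrow>
     (\<exists>C::real. \<forall>i\<in>I. linear_on_Lp p M (T i) \<and> Lp_opnorm p M (T i) \<le> ennreal C)"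

definition shrink :: "(real^'d \<Rightarrow> real^'d) \<Rightarrow> real \<Rightarrow> real^'d \<Rightarrow> real^'d" where
  "shrink j \<delta> x = x - \<delta> *\<^sub>R j x"

definition mollifier :: "real \<Rightarrow> real^'d \<Rightarrow> real" where
  "mollifier \<eta> y = (if norm y < 1 then \<eta> * exp (- (1 / (1 - (norm y)\<^sup>2))) else 0)"

definition K_grad ::
  "real \<Rightarrow> (real^'d \<Rightarrow> real^'d) \<Rightarrow> real \<Rightarrow> real \<Rightarrow> (real^'d \<Rightarrow> real) \<Rightarrow> real^'d \<Rightarrow> real" where
  "K_grad \<eta> j r \<delta> f x =
     (LINT y|lebesgue_on (ball 0 1). mollifier \<eta> y * f (shrink j \<delta> x + (\<delta> * r) *\<^sub>R y))"

definition K_op ::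
  "real \<Rightarrow> (real^'d \<Rightarrow> real^'d) \<Rightarrow> real \<Rightarrow> (real \<Rightarrow> real^'d \<Rightarrow> real^'q^'q) \<Rightarrow>
    real \<Rightarrow> (real^'d \<Rightarrow> real^'q) \<Rightarrow> real^'d \<Rightarrow> real^'q" where
  "K_op \<eta> j r A \<delta> g x = A \<delta> x *v (\<chi> i. K_grad \<eta> j r \<delta> (\<lambda>z. g z $ i) x)"

end

theory Submission
  imports Defs "HOL-Probability.Probability_Measure"
begin

text \<open>The operator averages \<open>f\<close> over the maps \<open>x \<mapsto> \<phi>\<^sub>\<delta>(x) + \<delta> r y\<close> against a probability measure in \<open>y\<close>, so
  by Jensen and Tonelli its \<open>L\<^sup>p\<close> bound reduces to the estimate
  \<open>|{x \<in> D. \<phi>\<^sub>\<delta>(x) + z \<in> E}| \<le> B |E|\<close> with \<open>B\<close> independent of \<open>\<delta>\<close> and \<open>z\<close>. As \<open>D\<close> is not convex,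
  \<open>\<phi>\<^sub>\<delta>\<close> need not be injective on \<open>D\<close>. But the Jacobian of \<open>j\<close> is uniformly continuous near \<open>D\<close>, so there
  is a radius independent of \<open>\<delta>\<close> such that \<open>\<phi>\<^sub>\<delta>\<close> contracts distances at most by the factor 4 on every ball
  of this radius centred in \<open>D\<close>, and finitely many such balls cover \<open>D\<close>. Convergence is clear for
  bounded continuous functions, and these are dense in \<open>L\<^sup>p\<close>.\<close>

subsection \<open>Measure of preimages under locally expanding maps\<close>

text \<open>The expansion inequality stands in for the change of variables formula: a cover by cubes
  turns it into a measure bound without determinants, at the price of a dimensional constant. The
  estimate is made in \<open>x\<close> with the point \<open>y\<close> of the unit ball fixed. The
  map that sends \<open>y\<close> to \<open>shrink j \<delta> x + (\<delta> * r) *\<^sub>R y\<close>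
  has slope \<open>\<delta> * r\<close>, so bounds obtained in the variable \<open>y\<close> would
  degenerate as \<delta> tends to 0. A second obstacle is measurability. An element of the space is
  only Lebesgue measurable on \<open>D\<close>, whereas Tonelli for the pair of \<open>x\<close> and
  \<open>y\<close> asks for Borel integrands. Each \<open>f\<close> is therefore traded for a Borel
  function \<open>f'\<close>. The same measure estimate, applied to the null set where the two
  differ, shows that for almost every \<open>x\<close> they agree along almost every
  \<open>y\<close>, so that their averages coincide almost everywhere. This also makes the operator
  independent of the representative.\<close>

text \<open>Cover \<open>E\<close> by dyadic cubes of total volume close to \<open>|E|\<close>: in dimension \<open>n\<close>, the preimage of a
  cube of side \<open>s\<close> has diameter at most \<open>B n s\<close>.\<close>

lemma emeasure_vimage_expanding:
  fixes \<phi> :: "'a::euclidean_space \<Rightarrow> 'a"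
  assumes S [measurable]: "S \<in> sets borel" and \<phi> [measurable]: "\<phi> \<in> borel_measurable borel"
    and exp: "\<And>u v. u \<in> S \<Longrightarrow> v \<in> S \<Longrightarrow> dist u v \<le> B * dist (\<phi> u) (\<phi> v)"
    and "B \<ge> 0" and E [measurable]: "E \<in> sets borel" and "bounded E"
  shows "emeasure lborel {x\<in>S. \<phi> x \<in> E} \<le> ennreal ((2 * B * DIM('a)) ^ DIM('a)) * emeasure lborel E"
proof -
  let ?n = "DIM('a)"
  let ?C = "ennreal ((2 * B * ?n) ^ ?n)"
  let ?W = "\<lambda>K. {x\<in>S. \<phi> x \<in> K}"
  obtain R where "R > 0" and R: "\<And>x. x \<in> E \<Longrightarrow> norm x \<le> R"
    using \<open>bounded E\<close> bounded_pos by blast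
  \<comment> \<open>Images of two preimage points are at distance at most \<open>?n * s\<close>, so
    the preimage lies in a cube of half-side \<open>B * (?n * s)\<close> around any of its points.
    The open box on the right has the same volume as the closed one; it is used because the covering
    cubes below are disjoint only in their interiors.\<close>
  have cube: "emeasure lborel (?W (cbox c d)) \<le> ?C * emeasure lborel (box c d)"
    if "s > 0" and s: "\<And>i. i \<in> Basis \<Longrightarrow> d \<bullet> i - c \<bullet> i = s" for c d s
  proof (cases "?W (cbox c d) = {}")
    case False
    then obtain x0 where x0: "x0 \<in> S" "\<phi> x0 \<in> cbox c d" by auto
    let ?t = "B * (?n * s)"
    have "?W (cbox c d) \<subseteq> cbox (x0 - ?t *\<^sub>R One) (x0 + ?t *\<^sub>R One)"
    proof safe
      fix x assume x: "x \<in> S" "\<phi> x \<in> cbox c d"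
      have "dist (\<phi> x) (\<phi> x0) \<le> (\<Sum>i\<in>Basis. \<bar>(\<phi> x - \<phi> x0) \<bullet> i\<bar>)"
        unfolding dist_norm by (rule norm_le_l1)
      also have "\<dots> \<le> (\<Sum>i\<in>(Basis::'a set). s)"
      proof (rule sum_mono)
        fix i :: 'a assume "i \<in> Basis"
        then have "c \<bullet> i \<le> \<phi> x \<bullet> i" "\<phi> x \<bullet> i \<le> d \<bullet> i" "c \<bullet> i \<le> \<phi> x0 \<bullet> i" "\<phi> x0 \<bullet> i \<le> d \<bullet> i"
          using x x0 by (auto simp: mem_box)
        then show "\<bar>(\<phi> x - \<phi> x0) \<bullet> i\<bar> \<le> s"
          using s[OF \<open>i \<in> Basis\<close>] unfolding inner_diff_left by linarith
      qed
      finally have "dist (\<phi> x) (\<phi> x0) \<le> ?n * s" by simp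
      then have "dist x x0 \<le> ?t"
        using exp[OF x(1) x0(1)] \<open>B \<ge> 0\<close> by (meson mult_left_mono order_trans)
      then have "x0 \<bullet> i - ?t \<le> x \<bullet> i \<and> x \<bullet> i \<le> x0 \<bullet> i + ?t" if "i \<in> Basis" for i
        using Basis_le_norm[OF that, of "x - x0"] unfolding dist_norm inner_diff_left abs_le_iff by linarith
      then show "x \<in> cbox (x0 - ?t *\<^sub>R One) (x0 + ?t *\<^sub>R One)"
        by (simp add: mem_box inner_diff_left inner_add_left)
    qed
    then have "emeasure lborel (?W (cbox c d)) \<le> emeasure lborel (cbox (x0 - ?t *\<^sub>R One) (x0 + ?t *\<^sub>R One))"
      by (intro emeasure_mono) auto
    also have "\<dots> = ennreal (\<Prod>i\<in>(Basis::'a set). 2 * ?t)"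
    proof -
      have t: "?t \<ge> 0" using \<open>s > 0\<close> \<open>B \<ge> 0\<close> by simp
      then show ?thesis
        unfolding emeasure_lborel_cbox_eq
        by (simp add: inner_diff_left inner_add_left field_simps)
    qed
    also have "\<dots> = ennreal ((2 * B * ?n) ^ ?n * s ^ ?n)"
      by (simp add: power_mult_distrib mult_ac)
    also have "\<dots> = ?C * ennreal (s ^ ?n)"
      using \<open>s > 0\<close> \<open>B \<ge> 0\<close> by (intro ennreal_mult) auto
    also have "ennreal (s ^ ?n) = emeasure lborel (box c d)"
    proof -
      have "c \<bullet> i \<le> d \<bullet> i" if "i \<in> Basis" for i using s[OF that] \<open>s > 0\<close> by simp
      then show ?thesis by (simp add: emeasure_lborel_box_eq s inner_diff_left)
    qed
    finally show ?thesis .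
  next
    case True
    show ?thesis unfolding True by simp
  qed
  have main: "emeasure lborel (?W E) \<le> ?C * emeasure lborel U" if "open U" "E \<subseteq> U" for U
  proof -
    \<comment> \<open>Equal sides of the big box make all dyadic pieces cubes, as
      \<open>cube\<close> demands.\<close>
    define a b where "a = (- R) *\<^sub>R (One::'a)" and "b = R *\<^sub>R (One::'a)"
    have ab: "b \<bullet> i = R" "a \<bullet> i = - R" if "i \<in> Basis" for i
      using that by (simp_all add: a_def b_def)
    have sub: "E \<subseteq> cbox a b"
    proof
      fix x assume "x \<in> E"
      then have "\<bar>x \<bullet> i\<bar> \<le> R" if "i \<in> Basis" for i
        using R Basis_le_norm[OF that, of x] by (meson order_trans)
      then show "x \<in> cbox a b" by (auto simp: mem_box abs_le_iff minus_le_iff ab)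
    qed
    \<comment> \<open>Each covering cube contains a tag in \<open>E\<close>, where the gauge is
      \<open>U\<close>; hence all cubes lie in \<open>U\<close>.\<close>
    define G where "G = (\<lambda>x. if x \<in> E then U else UNIV)"
    have "box a b \<noteq> {}"
      using \<open>R > 0\<close> by (simp add: box_ne_empty ab)
    moreover have "gauge G"
      using that by (auto simp: gauge_def G_def)
    ultimately show ?thesis
    proof (rule covering_lemma[OF sub])
      fix \<D> assume \<D>: "countable \<D>"
        and disj: "pairwise (\<lambda>A B. interior A \<inter> interior B = {}) \<D>" and cover: "E \<subseteq> \<Union>\<D>"
        and box: "\<And>K. K \<in> \<D> \<Longrightarrow> interior K \<noteq> {} \<and> (\<exists>c d. K = cbox c d)"
        and tag: "\<And>K. K \<in> \<D> \<Longrightarrow> \<exists>x \<in> E \<inter> K. K \<subseteq> G x"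
        and side: "\<And>u v. cbox u v \<in> \<D> \<Longrightarrow> \<exists>n. \<forall>i \<in> Basis. v \<bullet> i - u \<bullet> i = (b \<bullet> i - a \<bullet> i) / 2^n"
      \<comment> \<open>Enumerates the cubes without repetition and pads with the empty set. A
        repeated cube would destroy the disjointness of the interiors, and the padding treats finite
        and infinite families alike.\<close>
      define K where "K n = (if n \<in> to_nat_on \<D> ` \<D> then from_nat_into \<D> n else {})" for n
      have K_in: "K n \<in> \<D>" if "K n \<noteq> {}" for n
        using that from_nat_into[of \<D> n] unfolding K_def by (metis image_empty empty_iff)
      have K_onto: "\<exists>n. K n = k" if "k \<in> \<D>" for k
        using that from_nat_into_to_nat_on[OF \<D> that] unfolding K_def by (metis imageI)
      have K_inj: "m = n" if "K m \<noteq> {}" "K m = K n" for m n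
        using that to_nat_on_from_nat_into[of m \<D>] to_nat_on_from_nat_into[of n \<D>] unfolding K_def by metis
      have K_le: "emeasure lborel (?W (K n)) \<le> ?C * emeasure lborel (interior (K n))" for n
      proof (cases "K n = {}")
        case False
        then obtain c d where cd: "K n = cbox c d" using K_in box by blast
        then obtain m where m: "\<forall>i \<in> Basis. d \<bullet> i - c \<bullet> i = (b \<bullet> i - a \<bullet> i) / 2^m"
          using side K_in[OF False] by metis
        show ?thesis unfolding cd interior_cbox
          by (rule cube[of "2 * R / 2 ^ m"]) (use m \<open>R > 0\<close> in \<open>auto simp: ab\<close>)
      qed simp
      have meas: "K n \<in> sets borel" for n
        using K_in[of n] box by (cases "K n = {}") (auto, metis borel_closed closed_cbox)
      have mW: "?W (K n) \<in> sets lborel" for n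
      proof -
        have "?W (K n) = S \<inter> (\<phi> -` K n \<inter> space borel)" by auto
        then show ?thesis using measurable_sets[OF \<phi> meas[of n]] S by simp
      qed
      have "?W E \<subseteq> (\<Union>n. ?W (K n))"
      proof safe
        fix x assume "x \<in> S" "\<phi> x \<in> E"
        then obtain k where "k \<in> \<D>" "\<phi> x \<in> k" using cover by auto
        then show "x \<in> (\<Union>n. ?W (K n))" using K_onto[of k] \<open>x \<in> S\<close> by auto
      qed
      then have "emeasure lborel (?W E) \<le> emeasure lborel (\<Union>n. ?W (K n))"
        using mW by (intro emeasure_mono) auto
      also have "\<dots> \<le> (\<Sum>n. emeasure lborel (?W (K n)))"
        using mW by (intro emeasure_subadditive_countably) auto
      also have "\<dots> \<le> (\<Sum>n. ?C * emeasure lborel (interior (K n)))"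
        by (intro suminf_le K_le) auto
      also have "\<dots> = ?C * emeasure lborel (\<Union>n. interior (K n))"
      proof -
        have "disjoint_family (\<lambda>n. interior (K n))"
          unfolding disjoint_family_on_def
        proof safe
          fix m n x assume "m \<noteq> n" and x: "x \<in> interior (K m)" "x \<in> interior (K n)"
          then have "K m \<noteq> {}" "K n \<noteq> {}" by auto
          moreover from this have "K m \<noteq> K n" using K_inj \<open>m \<noteq> n\<close> by blast
          ultimately show "x \<in> {}" using disj x K_in[of m] K_in[of n] unfolding pairwise_def by blast
        qed
        then show ?thesis by (subst suminf_emeasure[symmetric]) auto
      qed
      also have "\<dots> \<le> ?C * emeasure lborel U"
      proof (intro mult_left_mono emeasure_mono)
        show "(\<Union>n. interior (K n)) \<subseteq> U"
        proof safe
          fix n x assume x: "x \<in> interior (K n)"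
          then have "K n \<noteq> {}" by auto
          then show "x \<in> U" using tag[OF K_in] x interior_subset unfolding G_def by fastforce
        qed
      qed (use \<open>open U\<close> in auto)
      finally show ?thesis .
    qed
  qed
  show ?thesis
  proof (rule ennreal_le_epsilon)
    fix e :: real assume "e > 0"
    \<comment> \<open>The excess of \<open>U\<close> over \<open>E\<close> is multiplied by
      \<open>?C\<close>, so it has to be at most \<open>e / ?C\<close>; the summand 1 covers
      \<open>B = 0\<close>.\<close>
    let ?e = "e / ((2 * B * ?n) ^ ?n + 1)"
    have pos: "(2 * B * ?n) ^ ?n \<ge> 0" using \<open>B \<ge> 0\<close> by simp
    then have "?e > 0" using \<open>e > 0\<close> by simp
    then obtain U where U: "open U" "E \<subseteq> U" "emeasure lborel (U - E) < ?e"
      using outer_regular_lborel[OF E] by blast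
    have "emeasure lborel U \<le> emeasure lborel E + emeasure lborel (U - E)"
      using emeasure_subadditive[of E lborel "U - E"] U by (simp add: Un_absorb1)
    also have "\<dots> \<le> emeasure lborel E + ennreal ?e"
      using U by (intro add_left_mono) auto
    finally have "emeasure lborel (?W E) \<le> ?C * (emeasure lborel E + ennreal ?e)"
      using main[OF U(1,2)] by (meson mult_left_mono order_trans zero_le)
    also have "\<dots> = ?C * emeasure lborel E + ennreal ((2 * B * ?n) ^ ?n * ?e)"
      by (subst ennreal_mult[OF pos less_imp_le[OF \<open>?e > 0\<close>]]) (rule distrib_left)
    also have "\<dots> \<le> ?C * emeasure lborel E + ennreal e"
      using pos \<open>e > 0\<close> by (intro add_left_mono ennreal_leI) (simp add: field_simps)
    finally show "emeasure lborel (?W E) \<le> ?C * emeasure lborel E + ennreal e" .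
  qed
qed

section \<open>Uniform local expansion of the maps \<open>shrink j \<delta>\<close>\<close>

lemma matrix_opnorm_jacobian:
  fixes F :: "real^'n \<Rightarrow> real^'n"
  assumes "F differentiable (at x)"
  shows "matrix_opnorm (jacobian F (at x) - mat 1) = onorm (\<lambda>v. frechet_derivative F (at x) v - v)"
proof -
  have "matrix (frechet_derivative F (at x)) *v v = frechet_derivative F (at x) v" for v
    using assms by (intro fun_cong[OF matrix_vector_mul(2)] linear_frechet_derivative)
  then show ?thesis
    unfolding matrix_opnorm_def jacobian_def
    by (intro arg_cong[where f = onorm] ext) (simp add: matrix_vector_mult_diff_rdistrib)
qed

lemma smooth_on_UNIV_differentiable:
  assumes "smooth_on UNIV F"
  shows "F differentiable (at x)" "continuous_on UNIV (\<lambda>x. frechet_derivative F (at x) h)"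
  using assms[unfolded smooth_on_def, THEN spec, of 1] by auto

text \<open>The hypothesis controls the derivative of \<delta> j only at points of \<open>D\<close>,
  but a ball around such a point may leave \<open>D\<close>. Uniform continuity of the derivative of
  \<open>j\<close> on a larger ball costs another 1/4, and \<delta> \<le> 1 keeps this loss
  independent of \<delta>. Thus \<delta> j has Lipschitz constant 1/2 + 1/4 = 3/4 on the convex set
  \<open>ball x s\<close>, and the identity minus \<delta> j contracts at most by 1 / (1 - 3/4) =
  4.\<close>

lemma shrink_locally_expanding:
  fixes j :: "real^'d \<Rightarrow> real^'d"
  assumes "bounded D" and smooth: "smooth_on UNIV j" and "\<delta>0 \<le> 1"
    and jac: "\<And>\<delta> x. \<delta> \<in> {0..\<delta>0} \<Longrightarrow> x \<in> D \<Longrightarrow>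
           matrix_opnorm (jacobian (shrink j \<delta>) (at x) - mat 1) \<le> 1 / 2"
  obtains s where "s > 0"
    "\<And>\<delta> x u v. \<delta> \<in> {0..\<delta>0} \<Longrightarrow> x \<in> D \<Longrightarrow> u \<in> ball x s \<Longrightarrow> v \<in> ball x s \<Longrightarrow>
       dist u v \<le> 4 * dist (shrink j \<delta> u) (shrink j \<delta> v)"
proof -
  let ?J = "\<lambda>x. frechet_derivative j (at x)"
  have der: "(j has_derivative ?J x) (at x)" for x
    using smooth_on_UNIV_differentiable(1)[OF smooth] frechet_derivative_works by blast
  then have bl: "bounded_linear (?J x)" for x
    by (rule has_derivative_bounded_linear)
  have bs: "bounded_linear (\<lambda>v. c *\<^sub>R f v)" if "bounded_linear f" for c and f :: "real^'d \<Rightarrow> real^'d"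
    using bounded_linear_compose[OF bounded_linear_scaleR_right that] .
  obtain R where R: "\<And>x. x \<in> D \<Longrightarrow> norm x \<le> R"
    using \<open>bounded D\<close> bounded_iff by blast
  have "continuous_on UNIV (\<lambda>x. matrix (?J x))"
    unfolding matrix_def
    by (intro continuous_on_vec_lambda continuous_on_component smooth_on_UNIV_differentiable(2)[OF smooth])
  then have "continuous_on (cball 0 (R + 1)) (\<lambda>x. matrix (?J x))"
    by (rule continuous_on_subset) simp
  then have "uniformly_continuous_on (cball 0 (R + 1)) (\<lambda>x. matrix (?J x))"
    by (rule compact_uniformly_continuous) simp
  note unif = this[unfolded uniformly_continuous_on_def, rule_format]
  \<comment> \<open>Entries of size at most \<open>e\<close> give an operator norm of at most
    \<open>e\<close> times the number of entries, which is 1/4.\<close>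
  define e where "e = 1 / (4 * real CARD('d) * real CARD('d))"
  have "e > 0" by (simp add: e_def)
  from unif[OF this] obtain s0 where "s0 > 0" and s0: "\<And>x z. x \<in> cball 0 (R + 1) \<Longrightarrow> z \<in> cball 0 (R + 1) \<Longrightarrow>
      dist z x < s0 \<Longrightarrow> dist (matrix (?J z)) (matrix (?J x)) < e"
    by blast
  \<comment> \<open>Radius at most 1 keeps \<open>ball x s\<close> inside
    \<open>cball 0 (R + 1)\<close>, where the uniform continuity is available.\<close>
  define s where "s = min s0 1"
  have near: "onorm (\<lambda>v. ?J z v - ?J x v) \<le> 1 / 4" if "x \<in> D" "z \<in> ball x s" for x z
  proof -
    let ?M = "matrix (?J z) - matrix (?J x)"
    have "norm z \<le> norm x + dist z x" using norm_triangle_sub[of z x] by (simp add: dist_norm)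
    then have "dist (matrix (?J z)) (matrix (?J x)) < e"
      using R[OF \<open>x \<in> D\<close>] \<open>z \<in> ball x s\<close>
      by (intro s0) (auto simp: s_def dist_commute)
    then have "norm ?M \<le> e" by (simp add: dist_norm)
    then have "\<bar>?M $ i $ k\<bar> \<le> e" for i k
      using component_le_norm_cart[of "?M $ i" k] Finite_Cartesian_Product.norm_nth_le[of ?M i] by linarith
    then have "onorm ((*v) ?M) \<le> real CARD('d) * real CARD('d) * e"
      by (rule onorm_le_matrix_component)
    also have "\<dots> = 1 / 4" by (simp add: e_def)
    also have "(*v) ?M = (\<lambda>v. ?J z v - ?J x v)"
      using bl by (simp add: fun_eq_iff matrix_vector_mult_diff_rdistrib fun_cong[OF matrix_vector_mul(3)])
    finally show ?thesis .
  qed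
  have der_shrink: "(shrink j \<delta> has_derivative (\<lambda>v. v - \<delta> *\<^sub>R ?J x v)) (at x)" for \<delta> x
    unfolding shrink_def[abs_def] by (intro derivative_intros der)
  have half: "onorm (\<lambda>v. \<delta> *\<^sub>R ?J x v) \<le> 1 / 2" if "\<delta> \<in> {0..\<delta>0}" "x \<in> D" for \<delta> x
  proof -
    have "frechet_derivative (shrink j \<delta>) (at x) = (\<lambda>v. v - \<delta> *\<^sub>R ?J x v)"
      using der_shrink frechet_derivative_at by metis
    moreover have "shrink j \<delta> differentiable (at x)"
      using der_shrink differentiable_def by blast
    ultimately have "onorm (\<lambda>v. - (\<delta> *\<^sub>R ?J x v)) \<le> 1 / 2"
      using jac[OF that] by (simp add: matrix_opnorm_jacobian)
    then show ?thesis by (simp add: onorm_neg)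
  qed
  have "dist u v \<le> 4 * dist (shrink j \<delta> u) (shrink j \<delta> v)"
    if \<delta>: "\<delta> \<in> {0..\<delta>0}" and "x \<in> D" and uv: "u \<in> ball x s" "v \<in> ball x s" for \<delta> x u v
  proof -
    have "norm (\<delta> *\<^sub>R j u - \<delta> *\<^sub>R j v) \<le> 3 / 4 * norm (u - v)"
    proof (rule differentiable_bound[where S = "ball x s" and f' = "\<lambda>z w. \<delta> *\<^sub>R ?J z w"])
      fix z assume z: "z \<in> ball x s"
      show "((\<lambda>z. \<delta> *\<^sub>R j z) has_derivative (\<lambda>w. \<delta> *\<^sub>R ?J z w)) (at z within ball x s)"
        by (rule has_derivative_at_withinI[OF has_derivative_scaleR_right[OF der]])
      have "onorm (\<lambda>w. \<delta> *\<^sub>R ?J x w + \<delta> *\<^sub>R (?J z w - ?J x w))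
          \<le> onorm (\<lambda>w. \<delta> *\<^sub>R ?J x w) + onorm (\<lambda>w. \<delta> *\<^sub>R (?J z w - ?J x w))"
        by (intro onorm_triangle bs bounded_linear_sub bl)
      also have "onorm (\<lambda>w. \<delta> *\<^sub>R (?J z w - ?J x w)) = \<bar>\<delta>\<bar> * onorm (\<lambda>w. ?J z w - ?J x w)"
        by (intro onorm_scaleR bounded_linear_sub bl)
      also have "\<dots> \<le> 1 * (1 / 4)"
        using \<delta> \<open>\<delta>0 \<le> 1\<close> by (intro mult_mono near \<open>x \<in> D\<close> z) (auto intro: onorm_pos_le bounded_linear_sub bl)
      finally show "onorm (\<lambda>w. \<delta> *\<^sub>R ?J z w) \<le> 3 / 4"
        using half[OF \<delta> \<open>x \<in> D\<close>] by (simp add: scaleR_diff_right)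
    qed (use uv in auto)
    moreover have "u - v = (shrink j \<delta> u - shrink j \<delta> v) + (\<delta> *\<^sub>R j u - \<delta> *\<^sub>R j v)"
      by (simp add: shrink_def)
    then have "norm (u - v) \<le> norm (shrink j \<delta> u - shrink j \<delta> v) + norm (\<delta> *\<^sub>R j u - \<delta> *\<^sub>R j v)"
      by (metis norm_triangle_ineq)
    ultimately show ?thesis unfolding dist_norm by linarith
  qed
  moreover have "s > 0" using \<open>s0 > 0\<close> by (simp add: s_def)
  ultimately show thesis by (rule that[rotated])
qed

text \<open>The radius does not depend on \<delta>, hence neither do the finite cover and the number
  of its balls, which bounds how often a point can be attained. Each ball contributes the constant
  of \<open>emeasure_vimage_expanding\<close> for the factor 4. Adding \<open>z\<close> changes no
  distances, so the bound is uniform in \<open>z\<close> as well.\<close>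

lemma shrink_pullback:
  fixes j :: "real^'d \<Rightarrow> real^'d"
  assumes "open D" "bounded D" and smooth: "smooth_on UNIV j" and "\<delta>0 \<le> 1"
    and jac: "\<And>\<delta> x. \<delta> \<in> {0..\<delta>0} \<Longrightarrow> x \<in> D \<Longrightarrow>
           matrix_opnorm (jacobian (shrink j \<delta>) (at x) - mat 1) \<le> 1 / 2"
  obtains B where "B \<ge> 0"
    "\<And>\<delta> z E. \<delta> \<in> {0..\<delta>0} \<Longrightarrow> E \<in> sets borel \<Longrightarrow> bounded E \<Longrightarrow>
      emeasure lborel {x\<in>D. shrink j \<delta> x + z \<in> E} \<le> ennreal B * emeasure lborel E"
proof -
  obtain s where "s > 0" and s: "\<And>\<delta> x u v. \<delta> \<in> {0..\<delta>0} \<Longrightarrow> x \<in> D \<Longrightarrow> u \<in> ball x s \<Longrightarrow> v \<in> ball x s \<Longrightarrow>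
       dist u v \<le> 4 * dist (shrink j \<delta> u) (shrink j \<delta> v)"
    using shrink_locally_expanding[OF assms(2-)] by blast
  have "compact (closure D)" using \<open>bounded D\<close> by simp
  \<comment> \<open>Centres in \<open>D\<close> suffice for the closure, because all balls have the
    same radius.\<close>
  moreover have "closure D \<subseteq> (\<Union>x\<in>D. ball x s)"
  proof
    fix x assume "x \<in> closure D"
    then obtain y where "y \<in> D" "dist y x < s" using \<open>s > 0\<close> closure_approachable by blast
    then show "x \<in> (\<Union>x\<in>D. ball x s)" by auto
  qed
  ultimately obtain T where T: "T \<subseteq> D" "finite T" "closure D \<subseteq> (\<Union>x\<in>T. ball x s)"
    by (elim compactE_image) auto
  let ?c = "(2 * 4 * real DIM(real^'d)) ^ DIM(real^'d)"
  show thesis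
  proof (rule that[of "card T * ?c"])
    fix \<delta> z and E :: "(real^'d) set"
    assume \<delta>: "\<delta> \<in> {0..\<delta>0}" and E: "E \<in> sets borel" "bounded E"
    have "continuous_on UNIV j"
      using smooth_on_UNIV_differentiable(1)[OF smooth] differentiable_imp_continuous_within
      by (auto simp: continuous_on_eq_continuous_within)
    then have meas: "(\<lambda>x. shrink j \<delta> x + z) \<in> borel_measurable borel"
      unfolding shrink_def by (intro borel_measurable_continuous_onI continuous_intros)
    let ?W = "\<lambda>x. {u\<in>D \<inter> ball x s. shrink j \<delta> u + z \<in> E}"
    have mW: "?W x \<in> sets lborel" for x
      using meas E \<open>open D\<close> by measurable
    have "{x\<in>D. shrink j \<delta> x + z \<in> E} \<subseteq> (\<Union>x\<in>T. ?W x)"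
      using T closure_subset by fastforce
    then have "emeasure lborel {x\<in>D. shrink j \<delta> x + z \<in> E} \<le> emeasure lborel (\<Union>x\<in>T. ?W x)"
      using mW T by (intro emeasure_mono) auto
    also have "\<dots> \<le> (\<Sum>x\<in>T. emeasure lborel (?W x))"
      using mW T by (intro emeasure_subadditive_finite) auto
    also have "\<dots> \<le> (\<Sum>x\<in>T. ennreal ?c * emeasure lborel E)"
    proof (rule sum_mono)
      fix x assume "x \<in> T"
      with T have "x \<in> D" by auto
      then show "emeasure lborel (?W x) \<le> ennreal ?c * emeasure lborel E"
        using s[OF \<delta>] \<open>open D\<close> E meas by (intro emeasure_vimage_expanding) auto
    qed
    also have "\<dots> = ennreal (card T * ?c) * emeasure lborel E"
      by (simp add: ennreal_mult ennreal_of_nat_eq_real_of_nat mult.assoc)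
    finally show "emeasure lborel {x\<in>D. shrink j \<delta> x + z \<in> E} \<le> ennreal (card T * ?c) * emeasure lborel E" .
  qed simp
qed

subsection \<open>Lebesgue measurable representatives and density\<close>

lemma AE_lebesgue_on_iff:
  assumes "S \<in> sets borel"
  shows "(AE x in lebesgue_on S. P x) \<longleftrightarrow> (AE x in lborel. x \<in> S \<longrightarrow> P x)"
proof -
  have "S \<inter> space lebesgue \<in> sets lebesgue" using assms by (simp add: sets_completionI_sets)
  then show ?thesis by (simp add: AE_restrict_space_iff AE_completion_iff)
qed

lemma nn_integral_lebesgue_on:
  assumes "S \<in> sets borel"
  shows "(\<integral>\<^sup>+x. h x \<partial>lebesgue_on S) = (\<integral>\<^sup>+x\<in>S. h x \<partial>lborel)"
  using assms by (simp add: nn_integral_restrict_space nn_integral_completion sets_completionI_sets)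

text \<open>Completeness of Lebesgue measure. It yields measurability of functions that are known
  only almost everywhere, such as the image of \<open>f\<close> under the operator.\<close>

lemma borel_measurable_lebesgue_on_AE:
  fixes f :: "'a::euclidean_space \<Rightarrow> 'b::euclidean_space"
  assumes S: "S \<in> sets borel" and f: "f \<in> borel_measurable (lebesgue_on S)"
    and eq: "AE x in lebesgue_on S. f x = g x"
  shows "g \<in> borel_measurable (lebesgue_on S)"
proof -
  have S': "S \<in> sets lebesgue" using S by (simp add: sets_completionI_sets)
  have "AE x in lebesgue. (if x \<in> S then f x else 0) = (if x \<in> S then g x else 0)"
    using eq unfolding AE_lebesgue_on_iff[OF S] AE_completion_iff by eventually_elim simp
  moreover have "(\<lambda>x. if x \<in> S then f x else 0) \<in> borel_measurable lebesgue"
    using f borel_measurable_if[OF S'] by blast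
  ultimately have "(\<lambda>x. if x \<in> S then g x else 0) \<in> borel_measurable lebesgue"
    by (rule borel_measurable_AE[rotated])
  then show ?thesis using borel_measurable_if[OF S'] by blast
qed

text \<open>The extension of \<open>f\<close> by 0 has a Borel representative in each coordinate;
  finitely many null sets are discarded and the coordinates reassembled.\<close>

lemma lebesgue_on_ex_borel_measurable:
  fixes f :: "'a::euclidean_space \<Rightarrow> 'b::euclidean_space"
  assumes S: "S \<in> sets borel" and f: "f \<in> borel_measurable (lebesgue_on S)"
  obtains f' where "f' \<in> borel_measurable borel" "AE x in lebesgue_on S. f x = f' x"
proof -
  have S': "S \<in> sets lebesgue" using S by (simp add: sets_completionI_sets)
  let ?f = "\<lambda>x. if x \<in> S then f x else 0"
  have f: "?f \<in> borel_measurable lebesgue"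
    using f borel_measurable_if[OF S'] by blast
  have "\<exists>g\<in>borel_measurable lborel. AE x in lborel. ?f x \<bullet> b = g x" for b
    by (intro completion_ex_borel_measurable_real borel_measurable_inner f borel_measurable_const)
  then obtain g where g: "\<And>b. g b \<in> borel_measurable lborel" "\<And>b. AE x in lborel. ?f x \<bullet> b = g b x"
    by metis
  let ?g = "\<lambda>x. \<Sum>b\<in>Basis. g b x *\<^sub>R b"
  show thesis
  proof (rule that[of ?g])
    show "?g \<in> borel_measurable borel" using g(1) by simp
    have "AE x in lborel. \<forall>b\<in>Basis. ?f x \<bullet> b = g b x"
      by (intro AE_finite_allI g) simp
    then show "AE x in lebesgue_on S. f x = ?g x"
      unfolding AE_lebesgue_on_iff[OF S]
    proof eventually_elim
      case (elim x)
      have "f x = ?g x" if "x \<in> S"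
      proof -
        have "f x = (\<Sum>b\<in>Basis. (?f x \<bullet> b) *\<^sub>R b)" using that by (simp add: euclidean_representation)
        also have "\<dots> = ?g x" using elim by (intro sum.cong) auto
        finally show ?thesis .
      qed
      then show ?case by simp
    qed
  qed
qed

text \<open>A crude substitute for the Minkowski inequality, from the bound of a sum by twice the
  maximum. The factor \<open>2 powr p\<close> is harmless, since only the smallness of integrals is
  at stake, and no roots appear.\<close>

lemma nn_integral_powr_norm_add_le:
  fixes u v :: "'a \<Rightarrow> 'b::{second_countable_topology,real_normed_vector}"
  assumes [measurable]: "u \<in> borel_measurable M" "v \<in> borel_measurable M" and "p \<ge> 0"
  shows "(\<integral>\<^sup>+x. ennreal (norm (u x + v x) powr p) \<partial>M) \<le>
    ennreal (2 powr p) * ((\<integral>\<^sup>+x. ennreal (norm (u x) powr p) \<partial>M) + (\<integral>\<^sup>+x. ennreal (norm (v x) powr p) \<partial>M))"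
proof -
  have "norm (u x + v x) powr p \<le> 2 powr p * (norm (u x) powr p + norm (v x) powr p)" for x
  proof -
    have "norm (u x + v x) \<le> 2 * max (norm (u x)) (norm (v x))"
      using norm_triangle_ineq[of "u x" "v x"] by linarith
    then have "norm (u x + v x) powr p \<le> (2 * max (norm (u x)) (norm (v x))) powr p"
      using \<open>p \<ge> 0\<close> by (intro powr_mono2) auto
    also have "\<dots> = 2 powr p * max (norm (u x)) (norm (v x)) powr p"
      by (intro powr_mult)
    also have "\<dots> \<le> 2 powr p * (norm (u x) powr p + norm (v x) powr p)"
      by (intro mult_left_mono) (auto simp: max_def)
    finally show ?thesis .
  qed
  then have "(\<integral>\<^sup>+x. ennreal (norm (u x + v x) powr p) \<partial>M) \<le>
      (\<integral>\<^sup>+x. ennreal (2 powr p) * (ennreal (norm (u x) powr p) + ennreal (norm (v x) powr p)) \<partial>M)"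
    by (intro nn_integral_mono) (simp add: ennreal_mult[symmetric] ennreal_plus[symmetric] ennreal_leI del: ennreal_plus)
  also have "\<dots> = ennreal (2 powr p) * ((\<integral>\<^sup>+x. ennreal (norm (u x) powr p) \<partial>M) + (\<integral>\<^sup>+x. ennreal (norm (v x) powr p) \<partial>M))"
    by (simp add: nn_integral_cmult nn_integral_add)
  finally show ?thesis .
qed

text \<open>Truncation by the metric projection onto a large ball reduces the density statement to bounded
  functions, for which almost everywhere approximation by continuous functions suffices.\<close>

lemma Lp_approx_bounded_continuous:
  fixes f :: "'a::euclidean_space \<Rightarrow> 'b::euclidean_space"
  assumes S: "S \<in> sets borel" "bounded S" and f [measurable]: "f \<in> borel_measurable (lebesgue_on S)"
    and "p \<ge> 1" and fin: "(\<integral>\<^sup>+x. ennreal (norm (f x) powr p) \<partial>lebesgue_on S) < \<infinity>" and "e > 0"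
  obtains g c where "continuous_on UNIV g" "\<And>x. norm (g x) \<le> c"
    "(\<integral>\<^sup>+x. ennreal (norm (f x - g x) powr p) \<partial>lebesgue_on S) \<le> ennreal e"
proof -
  let ?M = "lebesgue_on S"
  define T where "T n = closest_point (cball (0::'b) (real n))" for n
  have cont_T: "continuous_on UNIV (T n)" for n
    unfolding T_def by (intro continuous_on_closest_point) auto
  have T_le: "norm (T n v) \<le> n" for n v
    using closest_point_in_set[of "cball (0::'b) n" v] by (auto simp: T_def)
  have T_id: "T n v = v" if "norm v \<le> n" for n v
    using that by (simp add: T_def closest_point_self)
  \<comment> \<open>The origin belongs to the ball, so the nearest point is no farther from
    \<open>v\<close> than 0. This makes the power of the norm of \<open>f\<close> a dominating
    function below.\<close>
  have T_dist: "norm (v - T n v) \<le> norm v" for n v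
    using closest_point_le[of "cball (0::'b) n" 0 v] by (simp add: T_def dist_norm)
  have [measurable]: "T n \<in> borel_measurable borel" for n
    by (rule borel_measurable_continuous_onI[OF cont_T])
  \<comment> \<open>Two errors of size \<open>e'\<close> are added and then multiplied by
    \<open>2 powr p\<close>.\<close>
  define e' where "e' = e / (2 * 2 powr p)"
  have "e' > 0" using \<open>e > 0\<close> by (simp add: e'_def)
  have "(\<lambda>n. \<integral>\<^sup>+x. ennreal (norm (f x - T n (f x)) powr p) \<partial>?M) \<longlonglongrightarrow> (\<integral>\<^sup>+x. 0 \<partial>?M)"
  proof (rule nn_integral_dominated_convergence[where w = "\<lambda>x. ennreal (norm (f x) powr p)"])
    show "AE x in ?M. ennreal (norm (f x - T n (f x)) powr p) \<le> ennreal (norm (f x) powr p)" for n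
      using \<open>p \<ge> 1\<close> T_dist by (intro AE_I2 ennreal_leI powr_mono2) auto
    show "AE x in ?M. (\<lambda>n. ennreal (norm (f x - T n (f x)) powr p)) \<longlonglongrightarrow> 0"
    proof (rule AE_I2)
      fix x
      have "\<forall>\<^sub>F n in sequentially. ennreal (norm (f x - T n (f x)) powr p) = 0"
        using eventually_ge_at_top[of "nat \<lceil>norm (f x)\<rceil>"]
        by eventually_elim (simp add: T_id nat_le_iff ceiling_le_iff)
      then show "(\<lambda>n. ennreal (norm (f x - T n (f x)) powr p)) \<longlonglongrightarrow> 0"
        by (rule tendsto_eventually)
    qed
  qed (use fin in measurable)
  then have "\<forall>\<^sub>F n in sequentially. (\<integral>\<^sup>+x. ennreal (norm (f x - T n (f x)) powr p) \<partial>?M) < ennreal e'"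
    using \<open>e' > 0\<close> by (intro order_tendstoD) auto
  then obtain n where n: "(\<integral>\<^sup>+x. ennreal (norm (f x - T n (f x)) powr p) \<partial>?M) < ennreal e'"
    by (meson eventually_sequentially le_refl)
  have S': "S \<in> sets lebesgue" using S by (simp add: sets_completionI_sets)
  have "(\<lambda>x. if x \<in> S then T n (f x) else 0) \<in> borel_measurable lebesgue"
    by (subst borel_measurable_if[OF S']) measurable
  then have "(\<lambda>x. if x \<in> S then T n (f x) else 0) measurable_on UNIV"
    by (rule lebesgue_measurable_imp_measurable_on) simp
  then obtain N g where N: "negligible N" and g: "\<And>k. continuous_on UNIV (g k)"
    and lim: "\<And>x. x \<notin> N \<Longrightarrow> (\<lambda>k. g k x) \<longlonglongrightarrow> (if x \<in> S then T n (f x) else 0)"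
    unfolding measurable_on_def by auto
  have [measurable]: "g k \<in> borel_measurable ?M" for k
    using borel_measurable_continuous_onI[OF g] by (intro measurable_restrict_space1 measurable_completion) simp
  \<comment> \<open>The functions \<open>g k\<close> need not be bounded. Composing them with
    \<open>T n\<close> bounds the differences by \<open>2 * n\<close>, which is integrable on the
    bounded set \<open>S\<close>, and keeps the limit because \<open>T n\<close> fixes
    \<open>T n (f x)\<close>.\<close>
  have "(\<lambda>k. \<integral>\<^sup>+x. ennreal (norm (T n (f x) - T n (g k x)) powr p) \<partial>?M) \<longlonglongrightarrow> (\<integral>\<^sup>+x. 0 \<partial>?M)"
  proof (rule nn_integral_dominated_convergence[where w = "\<lambda>x. ennreal ((2 * real n) powr p)"])
    show "AE x in ?M. ennreal (norm (T n (f x) - T n (g k x)) powr p) \<le> ennreal ((2 * real n) powr p)" for k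
    proof (intro AE_I2 ennreal_leI powr_mono2)
      show "norm (T n (f x) - T n (g k x)) \<le> 2 * real n" for x
        using norm_triangle_ineq4[of "T n (f x)" "T n (g k x)"] T_le[of n "f x"] T_le[of n "g k x"] by linarith
    qed (use \<open>p \<ge> 1\<close> in auto)
    have "emeasure lborel S < \<infinity>" using S(2) by (rule emeasure_bounded_finite)
    then show "(\<integral>\<^sup>+x. ennreal ((2 * real n) powr p) \<partial>?M) < \<infinity>"
      using S by (simp add: emeasure_restrict_space sets_completionI_sets ennreal_mult_less_top)
    have "N \<in> null_sets lebesgue" using N negligible_iff_null_sets by blast
    then have "AE x in lebesgue. x \<notin> N" by (rule AE_not_in)
    then have "AE x in ?M. x \<notin> N"
      unfolding AE_lebesgue_on_iff[OF S(1)] AE_completion_iff by eventually_elim simp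
    then show "AE x in ?M. (\<lambda>k. ennreal (norm (T n (f x) - T n (g k x)) powr p)) \<longlonglongrightarrow> 0"
    proof (rule AE_mp, intro AE_I2 impI)
      fix x assume "x \<in> space ?M" "x \<notin> N"
      then have "(\<lambda>k. g k x) \<longlonglongrightarrow> T n (f x)" using lim[of x] by simp
      moreover have "isCont (T n) (T n (f x))"
        using cont_T continuous_on_eq_continuous_at open_UNIV by blast
      ultimately have "(\<lambda>k. T n (g k x)) \<longlonglongrightarrow> T n (T n (f x))"
        by (rule isCont_tendsto_compose[rotated])
      also have "T n (T n (f x)) = T n (f x)" by (rule T_id[OF T_le])
      finally have "(\<lambda>k. norm (T n (f x) - T n (g k x))) \<longlonglongrightarrow> norm (T n (f x) - T n (f x))"
        by (rule tendsto_norm[OF tendsto_diff[OF tendsto_const]])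
      then have "(\<lambda>k. norm (T n (f x) - T n (g k x))) \<longlonglongrightarrow> 0" by simp
      then have "(\<lambda>k. norm (T n (f x) - T n (g k x)) powr p) \<longlonglongrightarrow> 0"
        using \<open>p \<ge> 1\<close> by (intro tendsto_zero_powrI[where b = p]) auto
      from tendsto_ennrealI[OF this]
      show "(\<lambda>k. ennreal (norm (T n (f x) - T n (g k x)) powr p)) \<longlonglongrightarrow> 0" by simp
    qed
  qed measurable
  then have "\<forall>\<^sub>F k in sequentially. (\<integral>\<^sup>+x. ennreal (norm (T n (f x) - T n (g k x)) powr p) \<partial>?M) < ennreal e'"
    using \<open>e' > 0\<close> by (intro order_tendstoD) auto
  then obtain k where k: "(\<integral>\<^sup>+x. ennreal (norm (T n (f x) - T n (g k x)) powr p) \<partial>?M) < ennreal e'"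
    by (meson eventually_sequentially le_refl)
  show thesis
  proof (rule that[of "\<lambda>x. T n (g k x)" n])
    show "continuous_on UNIV (\<lambda>x. T n (g k x))"
      using continuous_on_compose2[OF cont_T g] by simp
    show "norm (T n (g k x)) \<le> real n" for x by (rule T_le)
    have "(\<integral>\<^sup>+x. ennreal (norm (f x - T n (g k x)) powr p) \<partial>?M)
        = (\<integral>\<^sup>+x. ennreal (norm ((f x - T n (f x)) + (T n (f x) - T n (g k x))) powr p) \<partial>?M)"
      by simp
    also have "\<dots> \<le> ennreal (2 powr p) * ((\<integral>\<^sup>+x. ennreal (norm (f x - T n (f x)) powr p) \<partial>?M)
        + (\<integral>\<^sup>+x. ennreal (norm (T n (f x) - T n (g k x)) powr p) \<partial>?M))"
      using \<open>p \<ge> 1\<close> by (intro nn_integral_powr_norm_add_le) auto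
    also have "\<dots> \<le> ennreal (2 powr p) * (ennreal e' + ennreal e')"
      using n k by (intro mult_left_mono add_mono) auto
    also have "\<dots> = ennreal e"
      using \<open>e > 0\<close> by (simp add: e'_def ennreal_plus[symmetric] ennreal_mult[symmetric] del: ennreal_plus)
    finally show "(\<integral>\<^sup>+x. ennreal (norm (f x - T n (g k x)) powr p) \<partial>?M) \<le> ennreal e" .
  qed
qed

subsection \<open>Averages over a family of maps\<close>

text \<open>Convexity gives the tangent inequality on the open half-line. The end point
  \<open>t = 0\<close> is computed separately: the tangent takes the value
  \<open>(1 - p) * m powr p\<close> there.\<close>

lemma powr_above_tangent:
  fixes m t p :: real
  assumes "p \<ge> 1" "m > 0" "t \<ge> 0"
  shows "m powr p + p * m powr (p - 1) * (t - m) \<le> t powr p"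
proof (cases "t = 0")
  case True
  have "m powr (p - 1) * m = m powr p"
    using \<open>m > 0\<close> by (simp add: powr_diff)
  then have "m powr p + p * m powr (p - 1) * (t - m) = (1 - p) * m powr p"
    using True by (simp add: algebra_simps)
  also have "\<dots> \<le> 0" using \<open>p \<ge> 1\<close> by (simp add: mult_nonpos_nonneg)
  finally show ?thesis using True by simp
next
  case False
  have "t powr p - m powr p \<ge> (p * m powr (p - 1)) * (t - m)"
  proof (rule convex_on_imp_above_tangent[OF powr_convex[OF \<open>p \<ge> 1\<close>]])
    show "((\<lambda>x. x powr p) has_real_derivative p * m powr (p - 1)) (at m within {0<..})"
      using \<open>m > 0\<close> by (auto intro!: derivative_eq_intros)
  qed (use assms False in \<open>auto simp: interior_open\<close>)
  then show ?thesis by simp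
qed

text \<open>Jensen, by integrating the tangent inequality at the mean, whose linear term has
  expectation 0. The tangent needs a positive mean; if the mean is 0 or the right-hand side is
  infinite, there is nothing to prove.\<close>

lemma (in prob_space) powr_expectation_le:
  fixes X :: "'a \<Rightarrow> real"
  assumes X: "integrable M X" "\<And>x. X x \<ge> 0" and "p \<ge> 1"
  shows "ennreal (expectation X powr p) \<le> (\<integral>\<^sup>+ x. ennreal (X x powr p) \<partial>M)"
proof (cases "(\<integral>\<^sup>+ x. ennreal (X x powr p) \<partial>M) < \<infinity> \<and> expectation X > 0")
  case True
  have [measurable]: "X \<in> borel_measurable M" using X by simp
  let ?m = "expectation X"
  have int: "integrable M (\<lambda>x. X x powr p)"
    using True by (intro integrableI_nonneg) auto
  have "?m powr p = expectation (\<lambda>x. ?m powr p + p * ?m powr (p - 1) * (X x - ?m))"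
    using X prob_space by simp
  also have "\<dots> \<le> expectation (\<lambda>x. X x powr p)"
    using X True \<open>p \<ge> 1\<close> by (intro integral_mono int powr_above_tangent) auto
  finally show ?thesis
    using int by (subst nn_integral_eq_integral) (auto intro: ennreal_leI)
next
  case False
  have "expectation X \<ge> 0" using X by (intro Bochner_Integration.integral_nonneg)
  with False show ?thesis by (cases "expectation X = 0") (auto simp: not_less top_unique)
qed

text \<open>Here \<nu> will be the mollifier density, \<open>Y\<close> the unit ball and \<Phi> the
  map \<open>shrink j \<delta> x + (\<delta> * r) *\<^sub>R y\<close>. Since \<Phi> maps
  \<open>D\<close> into itself, only the part of \<open>E\<close> inside \<open>D\<close> counts in
  \<open>pullback\<close>, which is why \<open>E\<close> may be unbounded there.\<close>

locale averaging = prob_space \<nu> for \<nu> :: "'a::euclidean_space measure" +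
  fixes D Y :: "'a set" and \<Phi> :: "'a \<Rightarrow> 'a \<Rightarrow> 'a" and B :: real
  assumes sets_\<nu> [measurable_cong]: "sets \<nu> = sets borel"
    and AE_Y: "AE y in \<nu>. y \<in> Y"
    and D_sets [measurable]: "D \<in> sets borel"
    and measurable_\<Phi>: "(\<lambda>z. \<Phi> (fst z) (snd z)) \<in> borel_measurable (borel \<Otimes>\<^sub>M borel)"
    and maps: "x \<in> D \<Longrightarrow> y \<in> Y \<Longrightarrow> \<Phi> x y \<in> D"
    and pullback: "y \<in> Y \<Longrightarrow> E \<in> sets borel \<Longrightarrow>
      emeasure lborel {x\<in>D. \<Phi> x y \<in> E} \<le> ennreal B * emeasure lborel (E \<inter> D)"
begin

lemma measurable_\<Phi>' [measurable (raw)]: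
  "f \<in> borel_measurable N \<Longrightarrow> g \<in> borel_measurable N \<Longrightarrow> (\<lambda>z. \<Phi> (f z) (g z)) \<in> borel_measurable N"
  using measurable_compose[OF measurable_Pair measurable_\<Phi>, of f N g] by simp

text \<open>The assumption \<open>pullback\<close> compares two measures: the image of Lebesgue
  measure on \<open>D\<close> under \<Phi> with fixed \<open>y\<close> lies below \<open>B\<close>
  times Lebesgue measure on \<open>D\<close>. Comparison of measures passes to integrals of
  nonnegative functions.\<close>

lemma nn_integral_pullback:
  assumes [measurable]: "h \<in> borel_measurable borel" and y: "y \<in> Y"
  shows "(\<integral>\<^sup>+x\<in>D. h (\<Phi> x y) \<partial>lborel) \<le> ennreal B * (\<integral>\<^sup>+x\<in>D. h x \<partial>lborel)"
proof -
  let ?M = "distr (density lborel (indicator D)) borel (\<lambda>x. \<Phi> x y)"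
  let ?N = "density lborel (\<lambda>x. ennreal B * indicator D x)"
  have sets_eq: "sets ?M = sets ?N" by simp
  have "?M \<le> ?N"
    unfolding le_measure[OF sets_eq]
  proof
    fix E assume "E \<in> sets ?M"
    then have [measurable]: "E \<in> sets borel" by simp
    have \<Phi>y: "(\<lambda>x. \<Phi> x y) \<in> borel_measurable borel" by measurable
    have [measurable]: "(\<lambda>x. \<Phi> x y) -` E \<in> sets borel"
      using measurable_sets[OF \<Phi>y, of E] by simp
    have "emeasure ?M E = (\<integral>\<^sup>+x. indicator D x * indicator ((\<lambda>x. \<Phi> x y) -` E) x \<partial>lborel)"
      by (simp add: emeasure_distr emeasure_density)
    also have "\<dots> = emeasure lborel (D \<inter> (\<lambda>x. \<Phi> x y) -` E)"
      unfolding indicator_inter_arith[symmetric] by (intro nn_integral_indicator) simp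
    also have "\<dots> = emeasure lborel {x\<in>D. \<Phi> x y \<in> E}"
      by (intro arg_cong[where f = "emeasure lborel"]) auto
    also have "\<dots> \<le> ennreal B * emeasure lborel (E \<inter> D)"
      by (rule pullback[OF y]) simp
    also have "\<dots> = (\<integral>\<^sup>+x. ennreal B * indicator (E \<inter> D) x \<partial>lborel)"
      by (subst nn_integral_cmult) auto
    also have "\<dots> = emeasure ?N E"
      by (auto simp: emeasure_density intro!: nn_integral_cong split: split_indicator)
    finally show "emeasure ?M E \<le> emeasure ?N E" .
  qed
  then have "nn_integral ?M h \<le> nn_integral ?N h"
    by (rule nn_integral_mono_measure[OF sets_eq])
  then show ?thesis
    by (simp add: nn_integral_distr nn_integral_density mult.assoc nn_integral_cmult mult.commute[of "indicator D _"])
qed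

lemma nn_integral_average:
  assumes [measurable]: "h \<in> borel_measurable borel"
  shows "(\<integral>\<^sup>+x\<in>D. (\<integral>\<^sup>+y. h (\<Phi> x y) \<partial>\<nu>) \<partial>lborel) \<le> ennreal B * (\<integral>\<^sup>+x\<in>D. h x \<partial>lborel)"
proof -
  interpret P: pair_sigma_finite lborel \<nu> ..
  have "(\<integral>\<^sup>+x\<in>D. (\<integral>\<^sup>+y. h (\<Phi> x y) \<partial>\<nu>) \<partial>lborel) = (\<integral>\<^sup>+x. (\<integral>\<^sup>+y. h (\<Phi> x y) * indicator D x \<partial>\<nu>) \<partial>lborel)"
    by (intro nn_integral_cong nn_integral_multc[symmetric]) measurable
  also have "\<dots> = (\<integral>\<^sup>+y. (\<integral>\<^sup>+x\<in>D. h (\<Phi> x y) \<partial>lborel) \<partial>\<nu>)"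
    by (intro P.Fubini'[symmetric]) measurable
  also have "\<dots> \<le> (\<integral>\<^sup>+y. ennreal B * (\<integral>\<^sup>+x\<in>D. h x \<partial>lborel) \<partial>\<nu>)"
    using AE_Y by (intro nn_integral_mono_AE) (auto elim!: eventually_mono intro: nn_integral_pullback)
  also have "\<dots> = ennreal B * (\<integral>\<^sup>+x\<in>D. h x \<partial>lborel)"
    by (simp add: emeasure_space_1)
  finally show ?thesis .
qed

text \<open>Apply \<open>nn_integral_average\<close> to the indicator of a null set containing the
  exceptional points of \<open>D\<close>. This carries almost everywhere statements, equality of
  representatives among them, from \<open>f\<close> to its averages.\<close>

lemma AE_average:
  assumes "AE x in lborel. x \<in> D \<longrightarrow> P x"
  shows "AE x in lborel. x \<in> D \<longrightarrow> (AE y in \<nu>. P (\<Phi> x y))"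
proof -
  obtain N where N: "N \<in> null_sets lborel" "{x. \<not> (x \<in> D \<longrightarrow> P x)} \<subseteq> N"
    using assms unfolding eventually_ae_filter by auto
  then have [measurable]: "N \<in> sets borel" by auto
  have "(\<integral>\<^sup>+x\<in>D. indicator N x \<partial>lborel) \<le> (\<integral>\<^sup>+x. indicator N x \<partial>lborel)"
    by (intro nn_integral_mono) (auto split: split_indicator)
  also have "\<dots> = 0" using N by auto
  finally have "(\<integral>\<^sup>+x\<in>D. (\<integral>\<^sup>+y. indicator N (\<Phi> x y) \<partial>\<nu>) \<partial>lborel) = 0"
    using nn_integral_average[of "indicator N"] by simp
  then have "AE x in lborel. (\<integral>\<^sup>+y. indicator N (\<Phi> x y) \<partial>\<nu>) * indicator D x = (0::ennreal)"
    by (subst (asm) nn_integral_0_iff_AE) measurable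
  then show ?thesis
  proof eventually_elim
    case (elim x)
    show ?case
    proof
      assume "x \<in> D"
      with elim have "(\<integral>\<^sup>+y. indicator N (\<Phi> x y) \<partial>\<nu>) = (0::ennreal)" by simp
      then have "AE y in \<nu>. indicator N (\<Phi> x y) = (0::ennreal)"
        by (subst (asm) nn_integral_0_iff_AE) measurable
      with AE_Y show "AE y in \<nu>. P (\<Phi> x y)"
      proof eventually_elim
        case (elim y)
        then have "\<Phi> x y \<notin> N" by (simp add: indicator_eq_0_iff)
        then show ?case using N(2) maps[OF \<open>x \<in> D\<close>] elim by blast
      qed
    qed
  qed
qed

text \<open>The Bochner integral is 0 where the integrand is not integrable, so the average is
  total, and the bounds on its norm hold trivially at such points.\<close>

definition average :: "('a \<Rightarrow> 'b::euclidean_space) \<Rightarrow> 'a \<Rightarrow> 'b" where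
  "average f x = (LINT y|\<nu>. f (\<Phi> x y))"

lemma measurable_average [measurable]:
  assumes [measurable]: "f \<in> borel_measurable borel"
  shows "average f \<in> borel_measurable borel"
  unfolding average_def[abs_def] by measurable

lemma AE_integrable_average:
  fixes f :: "'a \<Rightarrow> 'b::euclidean_space"
  assumes [measurable]: "f \<in> borel_measurable borel"
    and fin: "(\<integral>\<^sup>+x\<in>D. ennreal (norm (f x)) \<partial>lborel) < \<infinity>"
  shows "AE x in lborel. x \<in> D \<longrightarrow> integrable \<nu> (\<lambda>y. f (\<Phi> x y))"
proof -
  have "(\<integral>\<^sup>+x\<in>D. (\<integral>\<^sup>+y. ennreal (norm (f (\<Phi> x y))) \<partial>\<nu>) \<partial>lborel) \<le> ennreal B * (\<integral>\<^sup>+x\<in>D. ennreal (norm (f x)) \<partial>lborel)"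
    by (rule nn_integral_average) measurable
  also have "\<dots> < \<infinity>" using fin by (simp add: ennreal_mult_less_top)
  finally have "AE x in lborel. (\<integral>\<^sup>+y. ennreal (norm (f (\<Phi> x y))) \<partial>\<nu>) * indicator D x \<noteq> \<infinity>"
    by (intro nn_integral_PInf_AE) auto
  then show ?thesis
    by eventually_elim (auto simp: integrable_iff_bounded less_top)
qed

lemma powr_norm_average_le:
  fixes f :: "'a \<Rightarrow> 'b::euclidean_space"
  assumes [measurable]: "f \<in> borel_measurable borel" and "p \<ge> 1"
  shows "ennreal (norm (average f x) powr p) \<le> (\<integral>\<^sup>+y. ennreal (norm (f (\<Phi> x y)) powr p) \<partial>\<nu>)"
proof (cases "integrable \<nu> (\<lambda>y. f (\<Phi> x y))")
  case True
  have "norm (average f x) \<le> expectation (\<lambda>y. norm (f (\<Phi> x y)))"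
    unfolding average_def by (rule integral_norm_bound)
  then have "ennreal (norm (average f x) powr p) \<le> ennreal (expectation (\<lambda>y. norm (f (\<Phi> x y))) powr p)"
    using \<open>p \<ge> 1\<close> by (intro ennreal_leI powr_mono2) auto
  also have "\<dots> \<le> (\<integral>\<^sup>+y. ennreal (norm (f (\<Phi> x y)) powr p) \<partial>\<nu>)"
    using True \<open>p \<ge> 1\<close> by (intro powr_expectation_le) auto
  finally show ?thesis .
qed (simp add: average_def not_integrable_integral_eq)

lemma nn_integral_powr_average_le:
  fixes f :: "'a \<Rightarrow> 'b::euclidean_space"
  assumes [measurable]: "f \<in> borel_measurable borel" and "p \<ge> 1"
  shows "(\<integral>\<^sup>+x\<in>D. ennreal (norm (average f x) powr p) \<partial>lborel)
    \<le> ennreal B * (\<integral>\<^sup>+x\<in>D. ennreal (norm (f x) powr p) \<partial>lborel)"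
proof -
  have "(\<integral>\<^sup>+x\<in>D. ennreal (norm (average f x) powr p) \<partial>lborel)
      \<le> (\<integral>\<^sup>+x\<in>D. (\<integral>\<^sup>+y. ennreal (norm (f (\<Phi> x y)) powr p) \<partial>\<nu>) \<partial>lborel)"
    by (intro nn_integral_mono mult_right_mono powr_norm_average_le assms) auto
  also have "\<dots> \<le> ennreal B * (\<integral>\<^sup>+x\<in>D. ennreal (norm (f x) powr p) \<partial>lborel)"
    by (rule nn_integral_average) measurable
  finally show ?thesis .
qed

lemma norm_average_le:
  fixes f :: "'a \<Rightarrow> 'b::euclidean_space"
  assumes "AE y in \<nu>. norm (f (\<Phi> x y)) \<le> c" "c \<ge> 0"
  shows "norm (average f x) \<le> c"
proof (cases "integrable \<nu> (\<lambda>y. f (\<Phi> x y))")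
  case True
  have "norm (average f x) \<le> expectation (\<lambda>y. norm (f (\<Phi> x y)))"
    unfolding average_def by (rule integral_norm_bound)
  also have "\<dots> \<le> expectation (\<lambda>y. c)"
    using assms True by (intro integral_mono_AE) auto
  finally show ?thesis using prob_space by simp
qed (use assms in \<open>simp add: average_def not_integrable_integral_eq\<close>)

end

subsection \<open>Averaging operators on Lp\<close>

lemma Lp_norm_less_top_iff:
  "p \<noteq> \<infinity> \<Longrightarrow> Lp_norm p M f < \<infinity> \<longleftrightarrow> (\<integral>\<^sup>+ x. ennreal (norm (f x) powr enn2real p) \<partial>M) < \<infinity>"
  by (auto simp: Lp_norm_def Let_def less_top)

lemma Lp_norm_le:
  assumes p: "1 \<le> p" "p \<noteq> \<infinity>" and "a \<ge> 0"
    and "(\<integral>\<^sup>+ x. ennreal (norm (f x) powr enn2real p) \<partial>M) \<le> ennreal a"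
  shows "Lp_norm p M f \<le> ennreal (a powr (1 / enn2real p))"
proof -
  let ?I = "\<integral>\<^sup>+ x. ennreal (norm (f x) powr enn2real p) \<partial>M"
  have "?I \<noteq> \<infinity>" using assms(4) by (auto simp: top_unique)
  moreover have "enn2real ?I \<le> a" using assms by (intro enn2real_leI) auto
  ultimately show ?thesis
    using p by (auto simp: Lp_norm_def Let_def intro!: ennreal_leI powr_mono2)
qed

lemma enn2real_ge_1: "1 \<le> p \<Longrightarrow> p \<noteq> \<infinity> \<Longrightarrow> 1 \<le> enn2real p"
  using enn2real_mono[of 1 p] by (simp add: less_top)

text \<open>The operator norm is a supremum over the unit ball, so only the level 1 matters, and
  taking roots preserves it.\<close>

lemma Lp_norm_le_1D:
  assumes p: "1 \<le> p" "p \<noteq> \<infinity>" and "Lp_norm p M f \<le> 1"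
  shows "(\<integral>\<^sup>+ x. ennreal (norm (f x) powr enn2real p) \<partial>M) \<le> 1"
proof -
  let ?I = "\<integral>\<^sup>+ x. ennreal (norm (f x) powr enn2real p) \<partial>M"
  have P: "1 \<le> enn2real p" using p by (rule enn2real_ge_1)
  have "?I < \<infinity>"
    using assms by (subst Lp_norm_less_top_iff[OF p(2), symmetric]) (auto simp: le_less_trans)
  then have "?I \<noteq> \<infinity>" by simp
  then have le: "enn2real ?I powr (1 / enn2real p) \<le> 1"
    using assms by (simp add: Lp_norm_def Let_def)
  have "enn2real ?I \<le> 1"
  proof (rule ccontr)
    assume "\<not> enn2real ?I \<le> 1"
    then have "1 < enn2real ?I powr (1 / enn2real p)" using P by (intro gr_one_powr) auto
    with le show False by simp
  qed
  then have "ennreal (enn2real ?I) \<le> ennreal 1" by (rule ennreal_leI)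
  with \<open>?I \<noteq> \<infinity>\<close> show ?thesis by (simp add: less_top)
qed

text \<open>On a finite measure space, \<open>t \<le> 1 + t powr p\<close> for finite exponents and
  the essential bound otherwise give integrability. Hence averages exist almost everywhere for all
  exponents at once.\<close>

lemma Lp_space_imp_integrable:
  assumes p: "1 \<le> p" and fin: "emeasure M (space M) < \<infinity>" and f: "f \<in> Lp_space p M"
  shows "(\<integral>\<^sup>+ x. ennreal (norm (f x)) \<partial>M) < \<infinity>"
proof (cases "p = \<infinity>")
  case True
  let ?E = "esssup M (\<lambda>x. ennreal (norm (f x)))"
  have "?E < \<infinity>" using f True by (simp add: Lp_space_def Lp_norm_def)
  have "(\<integral>\<^sup>+ x. ennreal (norm (f x)) \<partial>M) \<le> (\<integral>\<^sup>+ x. ?E \<partial>M)"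
    by (intro nn_integral_mono_AE esssup_AE)
  also have "\<dots> < \<infinity>" using fin \<open>?E < \<infinity>\<close> by (simp add: ennreal_mult_less_top)
  finally show ?thesis .
next
  case False
  let ?p = "enn2real p"
  have [measurable]: "f \<in> borel_measurable M" using f by (simp add: Lp_space_def)
  have "?p \<ge> 1" using p False by (rule enn2real_ge_1)
  have le: "t \<le> 1 + t powr ?p" if "t \<ge> 0" for t
  proof (cases "t \<le> 1")
    case False
    then have "t powr 1 \<le> t powr ?p" using \<open>?p \<ge> 1\<close> by (intro powr_mono) auto
    then show ?thesis using False by simp
  qed (use powr_ge_zero[of t ?p] in linarith)
  have "(\<integral>\<^sup>+ x. ennreal (norm (f x)) \<partial>M) \<le> (\<integral>\<^sup>+ x. 1 + ennreal (norm (f x) powr ?p) \<partial>M)"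
  proof (rule nn_integral_mono)
    fix x show "ennreal (norm (f x)) \<le> 1 + ennreal (norm (f x) powr ?p)"
      using ennreal_leI[OF le[of "norm (f x)"]] by (simp add: ennreal_plus)
  qed
  also have "\<dots> = emeasure M (space M) + (\<integral>\<^sup>+ x. ennreal (norm (f x) powr ?p) \<partial>M)"
    by (subst nn_integral_add) auto
  also have "\<dots> < \<infinity>"
    using fin f Lp_norm_less_top_iff[OF False, of M f] by (simp add: Lp_space_def)
  finally show ?thesis .
qed

text \<open>\<open>T_eq\<close> prescribes \<open>T f x\<close> only at points where
  \<open>f\<close> agrees along \<Phi> with a Borel function whose average exists. At other points
  nothing is known about \<open>T f x\<close>; by \<open>T_average\<close> these points form a null
  set.\<close>

locale averaging_operator = averaging \<nu> D Y \<Phi> B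
  for \<nu> :: "(real^'d) measure" and D Y \<Phi> B +
  fixes A :: "real^'d \<Rightarrow> real^'q^'q" and c :: real
    and T :: "(real^'d \<Rightarrow> real^'q) \<Rightarrow> real^'d \<Rightarrow> real^'q"
  assumes bounded_D: "bounded D" and A_cont: "continuous_on D A"
    and A_le: "x \<in> D \<Longrightarrow> norm (A x *v v) \<le> c * norm v" and c_nonneg: "c \<ge> 0" and B_nonneg: "B \<ge> 0"
    and T_eq: "x \<in> D \<Longrightarrow> f' \<in> borel_measurable borel \<Longrightarrow> AE y in \<nu>. f (\<Phi> x y) = f' (\<Phi> x y) \<Longrightarrow>
      integrable \<nu> (\<lambda>y. f' (\<Phi> x y)) \<Longrightarrow> T f x = A x *v average f' x"
begin

abbreviation "L \<equiv> lebesgue_on D"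

lemma finite_D: "emeasure L (space L) < \<infinity>"
proof -
  have "emeasure lborel D < \<infinity>" using bounded_D by (rule emeasure_bounded_finite)
  then show ?thesis
    using D_sets by (simp add: emeasure_restrict_space sets_completionI_sets)
qed

lemma ae: "(AE x in L. P x) \<longleftrightarrow> (AE x in lborel. x \<in> D \<longrightarrow> P x)"
  by (rule AE_lebesgue_on_iff[OF D_sets])

lemma measurable_A_mult:
  assumes "g \<in> borel_measurable borel"
  shows "(\<lambda>x. A x *v g x) \<in> borel_measurable L"
proof -
  have "A \<in> borel_measurable L"
    using A_cont D_sets by (intro continuous_imp_measurable_on_sets_lebesgue sets_completionI_sets) auto
  moreover have "g \<in> borel_measurable L"
    using assms by (intro measurable_restrict_space1 measurable_completion) simp
  ultimately have "(\<lambda>x. (A x, g x)) \<in> borel_measurable L"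
    by (rule borel_measurable_Pair)
  moreover have "continuous_on UNIV (\<lambda>z::(real^'q^'q) \<times> (real^'q). fst z *v snd z)"
    unfolding matrix_vector_mult_def
    by (intro continuous_on_vec_lambda continuous_intros)
  then have "(\<lambda>z::(real^'q^'q) \<times> (real^'q). fst z *v snd z) \<in> borel_measurable borel"
    by (rule borel_measurable_continuous_onI)
  ultimately show ?thesis
    using measurable_compose[of "\<lambda>x. (A x, g x)" L borel "\<lambda>z. fst z *v snd z" borel] by simp
qed

text \<open>Both conditions of \<open>T_eq\<close> hold at almost every \<open>x\<close>:
  integrability because \<open>f'\<close> is integrable on \<open>D\<close>, agreement along \<Phi>
  because null sets pull back to null sets.\<close>

lemma T_average:
  assumes f: "f \<in> Lp_space p L" and p: "1 \<le> p"
    and f' [measurable]: "f' \<in> borel_measurable borel" and eq: "AE x in L. f x = f' x"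
  shows "AE x in L. integrable \<nu> (\<lambda>y. f' (\<Phi> x y)) \<and> T f x = A x *v average f' x"
proof -
  have "(\<integral>\<^sup>+x\<in>D. ennreal (norm (f' x)) \<partial>lborel) = (\<integral>\<^sup>+ x. ennreal (norm (f x)) \<partial>L)"
    unfolding nn_integral_lebesgue_on[OF D_sets, symmetric] using eq by (intro nn_integral_cong_AE) auto
  then have "AE x in lborel. x \<in> D \<longrightarrow> integrable \<nu> (\<lambda>y. f' (\<Phi> x y))"
    using Lp_space_imp_integrable[OF p finite_D f] by (intro AE_integrable_average) auto
  moreover have "AE x in lborel. x \<in> D \<longrightarrow> (AE y in \<nu>. f (\<Phi> x y) = f' (\<Phi> x y))"
    using eq unfolding ae by (rule AE_average)
  ultimately show ?thesis
    unfolding ae by eventually_elim (auto intro: T_eq)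
qed

lemma Lp_space_representative:
  assumes f: "f \<in> Lp_space p L" and p: "1 \<le> p"
  obtains f' where "f' \<in> borel_measurable borel" "AE x in L. f x = f' x"
    "AE x in L. integrable \<nu> (\<lambda>y. f' (\<Phi> x y)) \<and> T f x = A x *v average f' x"
proof -
  have "f \<in> borel_measurable L" using f by (simp add: Lp_space_def)
  then obtain f' where "f' \<in> borel_measurable borel" "AE x in L. f x = f' x"
    by (rule lebesgue_on_ex_borel_measurable[OF D_sets])
  with T_average[OF f p this] show thesis by (intro that)
qed

lemma T_measurable:
  assumes f: "f \<in> Lp_space p L" and p: "1 \<le> p"
  shows "T f \<in> borel_measurable L"
proof -
  obtain f' where f': "f' \<in> borel_measurable borel" "AE x in L. f x = f' x"
    "AE x in L. integrable \<nu> (\<lambda>y. f' (\<Phi> x y)) \<and> T f x = A x *v average f' x"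
    by (rule Lp_space_representative[OF f p])
  have "(\<lambda>x. A x *v average f' x) \<in> borel_measurable L"
    by (intro measurable_A_mult measurable_average f')
  moreover have "AE x in L. A x *v average f' x = T f x"
    using f'(3) by eventually_elim simp
  ultimately show ?thesis
    by (rule borel_measurable_lebesgue_on_AE[OF D_sets])
qed

lemma T_powr_le:
  assumes f: "f \<in> Lp_space p L" and p: "1 \<le> p" "p \<noteq> \<infinity>"
  defines "P \<equiv> enn2real p"
  shows "(\<integral>\<^sup>+ x. ennreal (norm (T f x) powr P) \<partial>L) \<le> ennreal (c powr P * B) * (\<integral>\<^sup>+ x. ennreal (norm (f x) powr P) \<partial>L)"
proof -
  have P: "P \<ge> 1" unfolding P_def using p by (rule enn2real_ge_1)
  obtain f' where f' [measurable]: "f' \<in> borel_measurable borel" and eq: "AE x in L. f x = f' x"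
    and T: "AE x in L. integrable \<nu> (\<lambda>y. f' (\<Phi> x y)) \<and> T f x = A x *v average f' x"
    by (rule Lp_space_representative[OF f p(1)])
  have "AE x in L. ennreal (norm (T f x) powr P) \<le> ennreal (c powr P) * ennreal (norm (average f' x) powr P)"
    using T AE_space
  proof eventually_elim
    case (elim x)
    then have "norm (T f x) powr P \<le> (c * norm (average f' x)) powr P"
      using A_le P by (intro powr_mono2) auto
    also have "\<dots> = c powr P * norm (average f' x) powr P" by (rule powr_mult)
    finally show ?case by (simp add: ennreal_mult[symmetric] ennreal_leI)
  qed
  then have "(\<integral>\<^sup>+ x. ennreal (norm (T f x) powr P) \<partial>L) \<le> (\<integral>\<^sup>+ x. ennreal (c powr P) * ennreal (norm (average f' x) powr P) \<partial>L)"
    by (rule nn_integral_mono_AE)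
  also have "\<dots> = ennreal (c powr P) * (\<integral>\<^sup>+ x. ennreal (norm (average f' x) powr P) \<partial>L)"
    by (intro nn_integral_cmult measurable_restrict_space1 measurable_completion) measurable
  also have "\<dots> \<le> ennreal (c powr P) * (ennreal B * (\<integral>\<^sup>+ x. ennreal (norm (f' x) powr P) \<partial>L))"
    unfolding nn_integral_lebesgue_on[OF D_sets]
    by (intro mult_left_mono nn_integral_powr_average_le f' P) simp
  also have "(\<integral>\<^sup>+ x. ennreal (norm (f' x) powr P) \<partial>L) = (\<integral>\<^sup>+ x. ennreal (norm (f x) powr P) \<partial>L)"
    using eq by (intro nn_integral_cong_AE) auto
  finally show ?thesis
    using B_nonneg by (simp add: ennreal_mult mult.assoc)
qed

text \<open>The essential bound of \<open>f\<close> passes through \<open>AE_average\<close> to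
  almost all \<open>y\<close>, and averaging against a probability measure does not increase it.
  Hence only the factor \<open>c\<close> of the matrix field remains.\<close>

lemma T_esssup_le:
  assumes f: "f \<in> Lp_space \<infinity> L"
  shows "Lp_norm \<infinity> L (T f) \<le> ennreal c * Lp_norm \<infinity> L f"
proof -
  let ?E = "esssup L (\<lambda>x. ennreal (norm (f x)))"
  have fin: "?E < \<infinity>" using f by (simp add: Lp_space_def Lp_norm_def)
  obtain f' where f' [measurable]: "f' \<in> borel_measurable borel" and eq: "AE x in L. f x = f' x"
    and T: "AE x in L. integrable \<nu> (\<lambda>y. f' (\<Phi> x y)) \<and> T f x = A x *v average f' x"
    by (rule Lp_space_representative[OF f]) simp
  have "AE x in L. norm (f' x) \<le> enn2real ?E"
    using eq esssup_AE[of "\<lambda>x. ennreal (norm (f x))" L]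
  proof eventually_elim
    case (elim x)
    then have "enn2real (ennreal (norm (f x))) \<le> enn2real ?E"
      using fin by (intro enn2real_mono) auto
    then show ?case using elim by simp
  qed
  then have "AE x in L. AE y in \<nu>. norm (f' (\<Phi> x y)) \<le> enn2real ?E"
    unfolding ae by (rule AE_average)
  with T AE_space have "AE x in L. ennreal (norm (T f x)) \<le> ennreal c * ?E"
  proof eventually_elim
    case (elim x)
    then have "norm (T f x) \<le> c * norm (average f' x)" using A_le by auto
    also have "\<dots> \<le> c * enn2real ?E"
      using elim c_nonneg by (intro mult_left_mono norm_average_le) auto
    finally have "ennreal (norm (T f x)) \<le> ennreal (c * enn2real ?E)" by (rule ennreal_leI)
    also have "\<dots> = ennreal c * ?E"
      using fin c_nonneg by (simp add: ennreal_mult)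
    finally show ?case .
  qed
  moreover have "T f \<in> borel_measurable L"
    using f by (rule T_measurable) simp
  ultimately show ?thesis
    unfolding Lp_norm_def by (simp add: esssup_I)
qed

lemma T_Lp_space:
  assumes f: "f \<in> Lp_space p L" and p: "1 \<le> p"
  shows "T f \<in> Lp_space p L"
proof -
  have "Lp_norm p L (T f) < \<infinity>"
  proof (cases "p = \<infinity>")
    case True
    have "ennreal c * Lp_norm \<infinity> L f < \<infinity>"
      using f True by (simp add: Lp_space_def ennreal_mult_less_top)
    then show ?thesis using T_esssup_le f unfolding True by (meson order_le_less_trans)
  next
    case False
    have "ennreal (c powr enn2real p * B) * (\<integral>\<^sup>+ x. ennreal (norm (f x) powr enn2real p) \<partial>L) < \<infinity>"
      using f Lp_norm_less_top_iff[OF False, of L f]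
      by (simp add: Lp_space_def ennreal_mult_less_top)
    then show ?thesis
      using T_powr_le[OF f p False] unfolding Lp_norm_less_top_iff[OF False] by (rule order_le_less_trans[rotated])
  qed
  then show ?thesis using T_measurable[OF f p] by (simp add: Lp_space_def)
qed

text \<open>The sum gets an exponent \<open>q\<close> of its own. In \<open>linear_on_Lp_T\<close>
  it is 1, where the triangle inequality alone shows that the sum belongs to the space.\<close>

lemma T_add:
  assumes f: "f \<in> Lp_space p L" and g: "g \<in> Lp_space p L" and fg: "(\<lambda>z. f z + g z) \<in> Lp_space q L"
    and p: "1 \<le> p" "1 \<le> q"
  shows "AE x in L. T (\<lambda>z. f z + g z) x = T f x + T g x"
proof -
  obtain f' where f': "f' \<in> borel_measurable borel" "AE x in L. f x = f' x"
    "AE x in L. integrable \<nu> (\<lambda>y. f' (\<Phi> x y)) \<and> T f x = A x *v average f' x"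
    by (rule Lp_space_representative[OF f p(1)])
  obtain g' where g': "g' \<in> borel_measurable borel" "AE x in L. g x = g' x"
    "AE x in L. integrable \<nu> (\<lambda>y. g' (\<Phi> x y)) \<and> T g x = A x *v average g' x"
    by (rule Lp_space_representative[OF g p(1)])
  have "AE x in L. f x + g x = f' x + g' x"
    using f'(2) g'(2) by eventually_elim simp
  then have "AE x in L. integrable \<nu> (\<lambda>y. f' (\<Phi> x y) + g' (\<Phi> x y)) \<and>
      T (\<lambda>z. f z + g z) x = A x *v average (\<lambda>z. f' z + g' z) x"
    using f'(1) g'(1) by (intro T_average[OF fg p(2)]) auto
  with f'(3) g'(3) show ?thesis
    by eventually_elim (simp add: average_def matrix_vector_right_distrib)
qed

lemma T_scaleR:
  assumes f: "f \<in> Lp_space p L" and af: "(\<lambda>z. a *\<^sub>R f z) \<in> Lp_space q L" and p: "1 \<le> p" "1 \<le> q"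
  shows "AE x in L. T (\<lambda>z. a *\<^sub>R f z) x = a *\<^sub>R T f x"
proof -
  obtain f' where f': "f' \<in> borel_measurable borel" "AE x in L. f x = f' x"
    "AE x in L. integrable \<nu> (\<lambda>y. f' (\<Phi> x y)) \<and> T f x = A x *v average f' x"
    by (rule Lp_space_representative[OF f p(1)])
  have "AE x in L. integrable \<nu> (\<lambda>y. a *\<^sub>R f' (\<Phi> x y)) \<and>
      T (\<lambda>z. a *\<^sub>R f z) x = A x *v average (\<lambda>z. a *\<^sub>R f' z) x"
    using f' by (intro T_average[OF af p(2)]) auto
  with f'(3) show ?thesis
    by eventually_elim (simp add: average_def matrix_vector_mult_scaleR)
qed

lemma T_cong:
  assumes f: "f \<in> Lp_space p L" and g: "g \<in> Lp_space p L" and p: "1 \<le> p" and eq: "AE x in L. f x = g x"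
  shows "AE x in L. T f x = T g x"
proof -
  obtain f' where f': "f' \<in> borel_measurable borel" "AE x in L. f x = f' x"
    "AE x in L. integrable \<nu> (\<lambda>y. f' (\<Phi> x y)) \<and> T f x = A x *v average f' x"
    by (rule Lp_space_representative[OF f p])
  have "AE x in L. g x = f' x" using eq f'(2) by eventually_elim simp
  from T_average[OF g p f'(1) this] f'(3) show ?thesis by eventually_elim simp
qed

lemma linear_on_Lp_T:
  assumes p: "1 \<le> p"
  shows "linear_on_Lp p L T"
  unfolding linear_on_Lp_def
proof (intro conjI ballI allI impI)
  fix f g :: "real^'d \<Rightarrow> real^'q" assume f: "f \<in> Lp_space p L" and g: "g \<in> Lp_space p L"
  have [measurable]: "f \<in> borel_measurable L" "g \<in> borel_measurable L"
    using f g by (simp_all add: Lp_space_def)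
  have "(\<integral>\<^sup>+x. ennreal (norm (f x + g x)) \<partial>L) \<le> (\<integral>\<^sup>+x. ennreal (norm (f x)) + ennreal (norm (g x)) \<partial>L)"
    by (intro nn_integral_mono) (simp add: ennreal_plus[symmetric] norm_triangle_ineq ennreal_leI del: ennreal_plus)
  also have "\<dots> = (\<integral>\<^sup>+x. ennreal (norm (f x)) \<partial>L) + (\<integral>\<^sup>+x. ennreal (norm (g x)) \<partial>L)"
    by (intro nn_integral_add) auto
  also have "\<dots> < \<infinity>"
    using Lp_space_imp_integrable[OF p finite_D f] Lp_space_imp_integrable[OF p finite_D g] by simp
  finally have "(\<lambda>z. f z + g z) \<in> Lp_space 1 L"
    using Lp_norm_less_top_iff[of 1 L "\<lambda>z. f z + g z"] by (simp add: Lp_space_def)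
  then show "AE x in L. T (\<lambda>z. f z + g z) x = T f x + T g x"
    by (rule T_add[OF f g _ p]) simp
next
  fix f :: "real^'d \<Rightarrow> real^'q" and a assume f: "f \<in> Lp_space p L"
  have [measurable]: "f \<in> borel_measurable L"
    using f by (simp add: Lp_space_def)
  have "(\<integral>\<^sup>+x. ennreal (norm (a *\<^sub>R f x)) \<partial>L) = ennreal \<bar>a\<bar> * (\<integral>\<^sup>+x. ennreal (norm (f x)) \<partial>L)"
    by (simp add: ennreal_mult nn_integral_cmult)
  also have "\<dots> < \<infinity>"
    using Lp_space_imp_integrable[OF p finite_D f] by (simp add: ennreal_mult_less_top)
  finally have "(\<lambda>z. a *\<^sub>R f z) \<in> Lp_space 1 L"
    using Lp_norm_less_top_iff[of 1 L "\<lambda>z. a *\<^sub>R f z"] by (simp add: Lp_space_def)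
  then show "AE x in L. T (\<lambda>z. a *\<^sub>R f z) x = a *\<^sub>R T f x"
    by (rule T_scaleR[OF f _ p]) simp
next
  fix f g :: "real^'d \<Rightarrow> real^'q" assume "f \<in> Lp_space p L" "g \<in> Lp_space p L" "AE x in L. f x = g x"
  then show "AE x in L. T f x = T g x" by (intro T_cong[OF _ _ p])
qed (rule T_Lp_space[OF _ p])

lemma Lp_opnorm_T_le:
  assumes p: "1 \<le> p" "p \<noteq> \<infinity>"
  shows "Lp_opnorm p L T \<le> ennreal ((c powr enn2real p * B) powr (1 / enn2real p))"
  unfolding Lp_opnorm_def
proof (rule SUP_least)
  fix f :: "real^'d \<Rightarrow> real^'q" assume "f \<in> {f \<in> Lp_space p L. Lp_norm p L f \<le> 1}"
  then have f: "f \<in> Lp_space p L" and "Lp_norm p L f \<le> 1" by auto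
  then have "(\<integral>\<^sup>+ x. ennreal (norm (f x) powr enn2real p) \<partial>L) \<le> 1"
    using p by (intro Lp_norm_le_1D)
  then have "ennreal (c powr enn2real p * B) * (\<integral>\<^sup>+ x. ennreal (norm (f x) powr enn2real p) \<partial>L)
      \<le> ennreal (c powr enn2real p * B) * 1"
    by (rule mult_left_mono) simp
  with T_powr_le[OF f p] have "(\<integral>\<^sup>+ x. ennreal (norm (T f x) powr enn2real p) \<partial>L) \<le> ennreal (c powr enn2real p * B)"
    by simp
  then show "Lp_norm p L (T f) \<le> ennreal ((c powr enn2real p * B) powr (1 / enn2real p))"
    using p B_nonneg by (intro Lp_norm_le) auto
qed

lemma Linf_opnorm_T_le: "Lp_opnorm \<infinity> L T \<le> ennreal c"
  unfolding Lp_opnorm_def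
proof (rule SUP_least)
  fix f :: "real^'d \<Rightarrow> real^'q" assume "f \<in> {f \<in> Lp_space \<infinity> L. Lp_norm \<infinity> L f \<le> 1}"
  then have f: "f \<in> Lp_space \<infinity> L" and "Lp_norm \<infinity> L f \<le> 1" by auto
  then have "ennreal c * Lp_norm \<infinity> L f \<le> ennreal c * 1"
    by (intro mult_left_mono) auto
  with T_esssup_le[OF f] show "Lp_norm \<infinity> L (T f) \<le> ennreal c" by simp
qed

text \<open>Splits \<open>T f - f\<close> into \<open>T (f - g)\<close>, \<open>T g - g\<close> and
  \<open>g - f\<close>. They contribute \<open>c powr P * B * e\<close>,
  \<open>(c * \<epsilon> + a * G) powr P\<close> times the volume of \<open>D\<close>, and
  \<open>e\<close>; each of the two splittings costs a factor \<open>2 powr P\<close>. The explicit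
  form lets all parameters be chosen later.\<close>

lemma T_minus_powr_le:
  assumes f: "f \<in> Lp_space p L" and p: "1 \<le> p" "p \<noteq> \<infinity>"
    and g_cont: "continuous_on UNIV g" and g_le: "\<And>x. norm (g x) \<le> G"
    and osc: "\<And>x y. x \<in> D \<Longrightarrow> y \<in> Y \<Longrightarrow> norm (g (\<Phi> x y) - g x) \<le> \<epsilon>" and "\<epsilon> \<ge> 0"
    and A_near: "\<And>x v. x \<in> D \<Longrightarrow> norm (A x *v v - v) \<le> a * norm v" and "a \<ge> 0"
    and e: "(\<integral>\<^sup>+ x. ennreal (norm (f x - g x) powr enn2real p) \<partial>L) \<le> ennreal e" and "e \<ge> 0"
  defines "P \<equiv> enn2real p"
  shows "(\<integral>\<^sup>+ x. ennreal (norm (T f x - f x) powr P) \<partial>L) \<le>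
    ennreal (2 powr P * (c powr P * B * e + 2 powr P * ((c * \<epsilon> + a * G) powr P * measure lborel D + e)))"
proof -
  have P: "P \<ge> 1" unfolding P_def using p by (rule enn2real_ge_1)
  have "G \<ge> 0" using g_le norm_ge_zero order_trans by blast
  have g [measurable]: "g \<in> borel_measurable borel"
    using g_cont by (rule borel_measurable_continuous_onI)
  then have gL [measurable]: "g \<in> borel_measurable L"
    by (intro measurable_restrict_space1 measurable_completion) simp
  have fL [measurable]: "f \<in> borel_measurable L" using f by (simp add: Lp_space_def)
  have D: "emeasure L (space L) = ennreal (measure lborel D)"
  proof -
    have "emeasure L (space L) = emeasure lborel D"
      using D_sets by (simp add: emeasure_restrict_space sets_completionI_sets)
    also have "\<dots> = ennreal (measure lborel D)"
      using emeasure_bounded_finite[OF bounded_D] by (intro emeasure_eq_ennreal_measure) simp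
    finally show ?thesis .
  qed
  have const: "(\<integral>\<^sup>+ x. ennreal k \<partial>L) = ennreal (k * measure lborel D)" if "k \<ge> 0" for k
    unfolding nn_integral_const D using that by (simp add: ennreal_mult)
  have "(\<integral>\<^sup>+ x. ennreal (norm (g x) powr P) \<partial>L) \<le> (\<integral>\<^sup>+ x. ennreal (G powr P) \<partial>L)"
    using P by (intro nn_integral_mono ennreal_leI powr_mono2 g_le) auto
  also have "\<dots> < \<infinity>" by (simp add: const del: nn_integral_const)
  finally have g_Lp: "g \<in> Lp_space p L"
    using Lp_norm_less_top_iff[OF p(2), of L g] gL by (simp add: Lp_space_def P_def)
  have "(\<integral>\<^sup>+ x. ennreal (norm (f x - g x) powr P) \<partial>L) < \<infinity>"
    using e unfolding P_def by (rule le_less_trans) simp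
  then have fg_Lp: "(\<lambda>x. f x - g x) \<in> Lp_space p L"
    using Lp_norm_less_top_iff[OF p(2), of L "\<lambda>x. f x - g x"] by (simp add: Lp_space_def P_def)
  have "AE x in L. T (\<lambda>z. (f z - g z) + g z) x = T (\<lambda>z. f z - g z) x + T g x"
    by (rule T_add[OF fg_Lp g_Lp _ p(1) p(1)]) (use f in simp)
  then have split: "AE x in L. T f x - f x = T (\<lambda>z. f z - g z) x + ((T g x - g x) + (g x - f x))"
    by eventually_elim simp
  \<comment> \<open>Averaging returns the constant \<open>g x\<close>, so the average of
    \<open>g\<close> is off by at most the oscillation \<epsilon>, which the matrix amplifies by
    \<open>c\<close>. Replacing the matrix by the identity costs at most
    \<open>a * G\<close>.\<close>
  have Tg: "AE x in L. norm (T g x - g x) \<le> c * \<epsilon> + a * G"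
    using T_average[OF g_Lp p(1) g AE_I2[OF refl]] AE_space
  proof eventually_elim
    case (elim x)
    then have "x \<in> D" by simp
    have "average g x - g x = average (\<lambda>z. g z - g x) x"
      using elim prob_space by (simp add: average_def)
    moreover have "norm (average (\<lambda>z. g z - g x) x) \<le> \<epsilon>"
      using AE_Y osc[OF \<open>x \<in> D\<close>] \<open>\<epsilon> \<ge> 0\<close> by (intro norm_average_le) auto
    ultimately have "norm (A x *v (average g x - g x)) \<le> c * \<epsilon>"
      using A_le[OF \<open>x \<in> D\<close>] c_nonneg by (metis mult_left_mono order_trans)
    moreover have "norm (A x *v g x - g x) \<le> a * G"
      using A_near[OF \<open>x \<in> D\<close>] g_le \<open>a \<ge> 0\<close> by (meson mult_left_mono order_trans)
    moreover have "T g x - g x = A x *v (average g x - g x) + (A x *v g x - g x)"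
      using elim by (simp add: matrix_vector_mult_diff_distrib)
    ultimately show ?case
      by (metis add_mono norm_triangle_le)
  qed
  have [measurable]: "T g \<in> borel_measurable L" "T (\<lambda>z. f z - g z) \<in> borel_measurable L"
    using T_measurable[OF g_Lp p(1)] T_measurable[OF fg_Lp p(1)] by auto
  have 1: "(\<integral>\<^sup>+ x. ennreal (norm (T (\<lambda>z. f z - g z) x) powr P) \<partial>L) \<le> ennreal (c powr P * B * e)"
  proof -
    have "(\<integral>\<^sup>+ x. ennreal (norm (T (\<lambda>z. f z - g z) x) powr P) \<partial>L) \<le> ennreal (c powr P * B) * ennreal e"
      using T_powr_le[OF fg_Lp p] e unfolding P_def by (meson mult_left_mono order_trans zero_le)
    then show ?thesis using B_nonneg \<open>e \<ge> 0\<close> by (simp add: ennreal_mult)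
  qed
  have 2: "(\<integral>\<^sup>+ x. ennreal (norm (T g x - g x) powr P) \<partial>L) \<le> ennreal ((c * \<epsilon> + a * G) powr P * measure lborel D)"
  proof -
    have "(\<integral>\<^sup>+ x. ennreal (norm (T g x - g x) powr P) \<partial>L) \<le> (\<integral>\<^sup>+ x. ennreal ((c * \<epsilon> + a * G) powr P) \<partial>L)"
      using Tg P by (intro nn_integral_mono_AE) (auto elim!: eventually_mono intro!: ennreal_leI powr_mono2)
    then show ?thesis by (simp add: const del: nn_integral_const)
  qed
  have 3: "(\<integral>\<^sup>+ x. ennreal (norm (g x - f x) powr P) \<partial>L) \<le> ennreal e"
    using e unfolding P_def by (simp add: norm_minus_commute)
  have "(\<integral>\<^sup>+ x. ennreal (norm (T f x - f x) powr P) \<partial>L)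
      = (\<integral>\<^sup>+ x. ennreal (norm (T (\<lambda>z. f z - g z) x + ((T g x - g x) + (g x - f x))) powr P) \<partial>L)"
  proof (rule nn_integral_cong_AE)
    show "AE x in L. ennreal (norm (T f x - f x) powr P)
        = ennreal (norm (T (\<lambda>z. f z - g z) x + ((T g x - g x) + (g x - f x))) powr P)"
      using split by eventually_elim (simp only:)
  qed
  also have "\<dots> \<le> ennreal (2 powr P) * ((\<integral>\<^sup>+ x. ennreal (norm (T (\<lambda>z. f z - g z) x) powr P) \<partial>L)
      + (\<integral>\<^sup>+ x. ennreal (norm ((T g x - g x) + (g x - f x)) powr P) \<partial>L))"
    using P by (intro nn_integral_powr_norm_add_le) auto
  also have "\<dots> \<le> ennreal (2 powr P) * (ennreal (c powr P * B * e) + ennreal (2 powr P) *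
      (ennreal ((c * \<epsilon> + a * G) powr P * measure lborel D) + ennreal e))"
    using P by (intro mult_left_mono add_mono 1 order_trans[OF nn_integral_powr_norm_add_le] 2 3) auto
  also have "\<dots> = ennreal (2 powr P * (c powr P * B * e + 2 powr P * ((c * \<epsilon> + a * G) powr P * measure lborel D + e)))"
    using \<open>e \<ge> 0\<close> B_nonneg by (simp add: ennreal_mult)
  finally show ?thesis .
qed

end

subsection \<open>Mollification\<close>

lemma borel_measurable_mollifier [measurable]: "mollifier \<eta> \<in> borel_measurable borel"
  unfolding mollifier_def[abs_def] by measurable

text \<open>The sign of \<eta> is forced by the normalisation: a negative \<eta> would give a
  nonpositive integral.\<close>

lemma mollifier_nonneg:
  assumes "(LINT y|lebesgue. mollifier \<eta> (y :: real^'d)) = 1"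
  shows "mollifier \<eta> (z :: real^'d) \<ge> 0"
proof -
  have "\<eta> \<ge> 0"
  proof (rule ccontr)
    assume "\<not> \<eta> \<ge> 0"
    then have "mollifier \<eta> y \<le> 0" for y :: "real^'d"
      by (simp add: mollifier_def mult_nonpos_nonneg)
    then have "(LINT y|lebesgue. mollifier \<eta> (y :: real^'d)) \<le> (LINT y|(lebesgue :: (real^'d) measure). 0)"
      by (intro integral_mono') auto
    with assms show False by simp
  qed
  then show ?thesis by (simp add: mollifier_def)
qed

lemma prob_space_mollifier:
  assumes "(LINT y|lebesgue. mollifier \<eta> (y :: real^'d)) = 1"
  shows "prob_space (density lborel (mollifier \<eta> :: real^'d \<Rightarrow> real))"
proof
  let ?\<rho> = "mollifier \<eta> :: real^'d \<Rightarrow> real"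
  have one: "(LINT y|lborel. ?\<rho> y) = 1"
    using assms by (subst (asm) integral_completion) auto
  \<comment> \<open>A function that is not integrable has integral 0, so the value 1 implies
    integrability.\<close>
  then have "integrable lborel ?\<rho>"
    using not_integrable_integral_eq by force
  then have "(\<integral>\<^sup>+y. ennreal (?\<rho> y) \<partial>lborel) = 1"
    using one mollifier_nonneg[OF assms] by (simp add: nn_integral_eq_integral)
  then show "emeasure (density lborel ?\<rho>) (space (density lborel ?\<rho>)) = 1"
    by (simp add: emeasure_density)
qed

lemma K_grad_eq:
  fixes f f' :: "real^'d \<Rightarrow> real^'q"
  assumes norm1: "(LINT y|lebesgue. mollifier \<eta> (y :: real^'d)) = 1"
    and [measurable]: "f' \<in> borel_measurable borel"
    and eq: "AE y in density lborel (mollifier \<eta>). f (shrink j \<delta> x + (\<delta> * r) *\<^sub>R y) = f' (shrink j \<delta> x + (\<delta> * r) *\<^sub>R y)"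
    and int: "integrable (density lborel (mollifier \<eta>)) (\<lambda>y. f' (shrink j \<delta> x + (\<delta> * r) *\<^sub>R y))"
  shows "K_grad \<eta> j r \<delta> (\<lambda>z. f z $ i) x
    = (LINT y|density lborel (mollifier \<eta>). f' (shrink j \<delta> x + (\<delta> * r) *\<^sub>R y)) $ i"
proof -
  let ?\<rho> = "mollifier \<eta> :: real^'d \<Rightarrow> real"
  let ?\<Phi> = "\<lambda>y. shrink j \<delta> x + (\<delta> * r) *\<^sub>R y"
  have \<rho>: "?\<rho> y \<ge> 0" for y by (rule mollifier_nonneg[OF norm1])
  have ball: "ball 0 1 \<inter> space lebesgue \<in> sets (lebesgue :: (real^'d) measure)" by simp
  have "(\<lambda>v. v $ i) \<in> borel_measurable (borel :: (real^'q) measure)"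
    by (intro borel_measurable_continuous_onI continuous_intros)
  then have [measurable]: "(\<lambda>y. f' (?\<Phi> y) $ i) \<in> borel_measurable borel"
    by (rule measurable_compose[rotated]) measurable
  have meas: "(\<lambda>y. ?\<rho> y * f' (?\<Phi> y) $ i) \<in> borel_measurable lborel" by measurable
  have meas': "(\<lambda>y. ?\<rho> y * f' (?\<Phi> y) $ i) \<in> borel_measurable lebesgue"
    using meas by (rule measurable_completion)
  have "(\<lambda>y. ennreal (?\<rho> y)) \<in> borel_measurable lborel" by measurable
  note AE_\<rho> = AE_density[OF this]
  have "AE y in lborel. ?\<rho> y * f' (?\<Phi> y) $ i = ?\<rho> y * f (?\<Phi> y) $ i"
    using eq unfolding AE_\<rho>
  proof eventually_elim
    case (elim y)
    then show ?case using \<rho>[of y] by (cases "?\<rho> y = 0") auto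
  qed
  then have ae: "AE y in lebesgue. ?\<rho> y * f' (?\<Phi> y) $ i = ?\<rho> y * f (?\<Phi> y) $ i"
    by (rule AE_completion)
  have "K_grad \<eta> j r \<delta> (\<lambda>z. f z $ i) x = (LINT y|lebesgue. indicator (ball 0 1) y *\<^sub>R (?\<rho> y * f (?\<Phi> y) $ i))"
    unfolding K_grad_def by (rule integral_restrict_space[OF ball])
  also have "\<dots> = (LINT y|lebesgue. ?\<rho> y * f (?\<Phi> y) $ i)"
    by (intro Bochner_Integration.integral_cong) (auto simp: mollifier_def indicator_def)
  also have "\<dots> = (LINT y|lebesgue. ?\<rho> y * f' (?\<Phi> y) $ i)"
    using ae borel_measurable_AE[OF meas' ae] meas' by (intro integral_cong_AE) auto
  also have "\<dots> = (LINT y|lborel. ?\<rho> y *\<^sub>R (f' (?\<Phi> y) $ i))"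
    using meas by (simp add: integral_completion)
  also have "\<dots> = (LINT y|density lborel ?\<rho>. f' (?\<Phi> y) $ i)"
    using \<rho> by (intro integral_density[symmetric]) auto
  also have "\<dots> = (LINT y|density lborel ?\<rho>. f' (?\<Phi> y)) $ i"
    by (rule integral_bounded_linear[OF bounded_linear_vec_nth int])
  finally show ?thesis .
qed

lemma averaging_operator_K_op:
  fixes D :: "(real^'d) set" and A :: "real \<Rightarrow> real^'d \<Rightarrow> real^'q^'q"
  assumes D: "open D" "bounded D" and j: "continuous_on UNIV j"
    and maps: "\<And>x y. x \<in> D \<Longrightarrow> y \<in> ball 0 1 \<Longrightarrow> shrink j \<delta> x + (\<delta> * r) *\<^sub>R y \<in> D"
    and norm1: "(LINT y|lebesgue. mollifier \<eta> (y :: real^'d)) = 1"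
    and pull: "\<And>z E. E \<in> sets borel \<Longrightarrow> bounded E \<Longrightarrow>
      emeasure lborel {x\<in>D. shrink j \<delta> x + z \<in> E} \<le> ennreal B * emeasure lborel E"
    and "B \<ge> 0" "c \<ge> 0" and A: "continuous_on D (A \<delta>)"
    and A_le: "\<And>x v. x \<in> D \<Longrightarrow> norm (A \<delta> x *v v) \<le> c * norm v"
  shows "averaging_operator (density lborel (mollifier \<eta>)) D (ball 0 1)
    (\<lambda>x y. shrink j \<delta> x + (\<delta> * r) *\<^sub>R y) B (A \<delta>) c (K_op \<eta> j r A \<delta>)"
proof -
  let ?\<nu> = "density lborel (mollifier \<eta> :: real^'d \<Rightarrow> real)"
  let ?\<Phi> = "\<lambda>x y. shrink j \<delta> x + (\<delta> * r) *\<^sub>R y"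
  interpret prob_space ?\<nu> by (rule prob_space_mollifier[OF norm1])
  have [measurable]: "j \<in> borel_measurable borel" using j by (rule borel_measurable_continuous_onI)
  interpret averaging ?\<nu> D "ball 0 1" ?\<Phi> B
  proof
    show "AE y in ?\<nu>. y \<in> ball 0 1"
      by (subst AE_density) (auto simp: mollifier_def)
    show "(\<lambda>z. ?\<Phi> (fst z) (snd z)) \<in> borel_measurable (borel \<Otimes>\<^sub>M borel)"
      unfolding shrink_def by measurable
    show "emeasure lborel {x\<in>D. ?\<Phi> x y \<in> E} \<le> ennreal B * emeasure lborel (E \<inter> D)"
      if "y \<in> ball 0 1" "E \<in> sets borel" for y E
    proof -
      \<comment> \<open>The estimate \<open>pull\<close> covers bounded sets only; invariance of
        \<open>D\<close> allows \<open>E\<close> to be cut down to the bounded set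
        \<open>E \<inter> D\<close>.\<close>
      have "{x\<in>D. ?\<Phi> x y \<in> E} = {x\<in>D. ?\<Phi> x y \<in> E \<inter> D}" using maps that by auto
      then show ?thesis using pull[of "E \<inter> D"] that D by (simp add: bounded_Int)
    qed
  qed (use D maps in auto)
  show ?thesis
  proof
    fix x and f f' :: "real^'d \<Rightarrow> real^'q"
    assume "x \<in> D" "f' \<in> borel_measurable borel" "AE y in ?\<nu>. f (?\<Phi> x y) = f' (?\<Phi> x y)"
      "integrable ?\<nu> (\<lambda>y. f' (?\<Phi> x y))"
    then have "(\<chi> i. K_grad \<eta> j r \<delta> (\<lambda>z. f z $ i) x) = average f' x"
      unfolding average_def by (simp add: vec_eq_iff K_grad_eq[OF norm1])
    then show "K_op \<eta> j r A \<delta> f x = A \<delta> x *v average f' x" by (simp add: K_op_def)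
  qed (use assms in auto)
qed

lemma matrix_deriv_norm_0: "matrix_deriv_norm 0 F x = matrix_opnorm (F x)"
proof -
  have "{hs. length hs = 0 \<and> (\<forall>h\<in>set hs. norm h \<le> 1)} = {[]}" by auto
  then show ?thesis by (simp add: matrix_deriv_norm_def)
qed

lemma norm_matrix_vector_le_opnorm: "norm (M *v v) \<le> matrix_opnorm M * norm v"
  for M :: "real^'n^'m"
  unfolding matrix_opnorm_def by (rule onorm) (rule matrix_vector_mul_bounded_linear)

theorem theorem3p3:
  fixes D :: "(real^'d) set"
    and j :: "real^'d \<Rightarrow> real^'d"
    and r \<delta>0 \<eta> :: real
    and A :: "real \<Rightarrow> real^'d \<Rightarrow> real^'q^'q"
  assumes "open D" "bounded D" "connected D" "strongly_lipschitz D"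
    and "smooth_on UNIV j"
    and "\<forall>x\<in>frontier D. norm (j x) = 1"
    and "globally_transversal D j"
    and "r > 0"
    and "\<forall>\<delta>\<in>{0..1}. \<forall>x\<in>D. \<forall>y\<in>ball 0 1. shrink j \<delta> x + (\<delta> * r) *\<^sub>R y \<in> D"
    and "0 < \<delta>0" "\<delta>0 \<le> 1"
    and "\<forall>\<delta>\<in>{0..\<delta>0}. \<forall>x\<in>D.
           matrix_opnorm (jacobian (shrink j \<delta>) (at x) - mat 1) \<le> 1 / 2 \<and>
           matrix_opnorm (matrix_inv (jacobian (shrink j \<delta>) (at x))) \<le> 2 \<and>
           \<bar>det (matrix_inv (jacobian (shrink j \<delta>) (at x)))\<bar> \<le> 2 ^ CARD('d)"
    and "(LINT y|lebesgue. mollifier \<eta> (y :: real^'d)) = 1"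
    and "\<forall>\<delta>\<in>{0..1}. smooth_on D (A \<delta>)"
    and "\<forall>l. \<exists>c. \<forall>\<delta>\<in>{0..1}. \<forall>x\<in>D. matrix_deriv_norm l (\<lambda>z. A \<delta> z - mat 1) x \<le> c * \<delta>"
  shows "(\<forall>p\<ge>1. unif_bounded_on_Lp p (lebesgue_on D) {0..\<delta>0} (K_op \<eta> j r A)) \<and>
         (\<forall>p f. 1 \<le> p \<and> p < \<infinity> \<and> f \<in> Lp_space p (lebesgue_on D) \<longrightarrow>
            ((\<lambda>\<delta>. Lp_norm p (lebesgue_on D) (\<lambda>x. K_op \<eta> j r A \<delta> f x - f x)) \<longlongrightarrow> 0)
              (at 0 within {0..\<delta>0}))"
proof -
  note D = assms(1,2) and smooth = assms(5) and \<delta>0 = assms(10,11) and norm1 = assms(13)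
  let ?L = "lebesgue_on D" and ?K = "K_op \<eta> j r A" and ?\<Phi> = "\<lambda>\<delta> x y. shrink j \<delta> x + (\<delta> * r) *\<^sub>R y"
  have I: "\<delta> \<in> {0..1}" if "\<delta> \<in> {0..\<delta>0}" for \<delta> using that \<delta>0 by auto
  have maps: "?\<Phi> \<delta> x y \<in> D" if "\<delta> \<in> {0..\<delta>0}" "x \<in> D" "y \<in> ball 0 1" for \<delta> x y
    using assms(9) I that by blast
  obtain B where "B \<ge> 0" and B: "\<And>\<delta> z E. \<delta> \<in> {0..\<delta>0} \<Longrightarrow> E \<in> sets borel \<Longrightarrow> bounded E \<Longrightarrow>
      emeasure lborel {x\<in>D. shrink j \<delta> x + z \<in> E} \<le> ennreal B * emeasure lborel E"
    by (rule shrink_pullback[OF D smooth \<delta>0(2)]) (use assms(12) in auto)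
  obtain c0 where c0: "\<And>\<delta> x. \<delta> \<in> {0..1} \<Longrightarrow> x \<in> D \<Longrightarrow> matrix_deriv_norm 0 (\<lambda>z. A \<delta> z - mat 1) x \<le> c0 * \<delta>"
    using assms(15) by blast
  \<comment> \<open>The bound at order \<open>l = 0\<close> says nothing about the sign of
    \<open>c0\<close>; the absolute value makes the constant nonnegative.\<close>
  define a where "a = \<bar>c0\<bar>"
  have A_near: "norm (A \<delta> x *v v - v) \<le> (a * \<delta>) * norm v" if "\<delta> \<in> {0..\<delta>0}" "x \<in> D" for \<delta> x v
  proof -
    have "A \<delta> x *v v - v = (A \<delta> x - mat 1) *v v" by (simp add: matrix_vector_mult_diff_rdistrib)
    then have "norm (A \<delta> x *v v - v) \<le> matrix_opnorm (A \<delta> x - mat 1) * norm v"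
      by (simp only: norm_matrix_vector_le_opnorm)
    also have "\<dots> \<le> (a * \<delta>) * norm v"
    proof (rule mult_right_mono)
      have "matrix_opnorm (A \<delta> x - mat 1) \<le> c0 * \<delta>"
        using c0[OF I] that by (simp add: matrix_deriv_norm_0)
      also have "\<dots> \<le> a * \<delta>" using that by (intro mult_right_mono) (auto simp: a_def)
      finally show "matrix_opnorm (A \<delta> x - mat 1) \<le> a * \<delta>" .
    qed simp
    finally show ?thesis .
  qed
  \<comment> \<open>The identity contributes 1 and the deviation at most \<open>a\<close>, as
    \<delta> \<le> 1.\<close>
  define c where "c = 1 + a"
  have "c \<ge> 0" by (simp add: c_def a_def)
  have A_le: "norm (A \<delta> x *v v) \<le> c * norm v" if "\<delta> \<in> {0..\<delta>0}" "x \<in> D" for \<delta> x v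
  proof -
    have "norm (A \<delta> x *v v) \<le> norm v + (a * \<delta>) * norm v"
      using A_near[OF that, of v] norm_triangle_sub[of "A \<delta> x *v v" v] by linarith
    also have "(a * \<delta>) * norm v \<le> (a * 1) * norm v"
      using I[OF that(1)] by (intro mult_right_mono mult_left_mono) (auto simp: a_def)
    finally show ?thesis by (simp add: c_def distrib_right)
  qed
  have j_cont: "continuous_on UNIV j"
    using smooth_on_UNIV_differentiable(1)[OF smooth] differentiable_imp_continuous_within
    by (auto simp: continuous_on_eq_continuous_within)
  have op: "averaging_operator (density lborel (mollifier \<eta>)) D (ball 0 1) (?\<Phi> \<delta>) B (A \<delta>) c (?K \<delta>)"
    if "\<delta> \<in> {0..\<delta>0}" for \<delta>
  proof (rule averaging_operator_K_op[OF D j_cont _ norm1 _ \<open>B \<ge> 0\<close> \<open>c \<ge> 0\<close>])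
    have "Ck_on 0 D (A \<delta>)" using assms(14) I[OF that] unfolding smooth_on_def by blast
    then show "continuous_on D (A \<delta>)" by simp
  qed (use that maps B A_le in auto)
  show ?thesis
  proof (intro conjI allI impI)

    \<comment> \<open>Uniform boundedness\<close>
    fix p :: ennreal assume p: "1 \<le> p"
    define C where "C = (if p = \<infinity> then c else (c powr enn2real p * B) powr (1 / enn2real p))"
    have "linear_on_Lp p ?L (?K \<delta>) \<and> Lp_opnorm p ?L (?K \<delta>) \<le> ennreal C" if "\<delta> \<in> {0..\<delta>0}" for \<delta>
    proof -
      interpret averaging_operator "density lborel (mollifier \<eta>)" D "ball 0 1" "?\<Phi> \<delta>" B "A \<delta>" c "?K \<delta>"
        by (rule op[OF that])
      show ?thesis
        using linear_on_Lp_T[OF p] Lp_opnorm_T_le[OF p] Linf_opnorm_T_le by (simp add: C_def)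
    qed
    then show "unif_bounded_on_Lp p ?L {0..\<delta>0} ?K"
      unfolding unif_bounded_on_Lp_def by blast
  next

    \<comment> \<open>Strong convergence as \<delta> tends to 0\<close>
    fix p :: ennreal and f :: "real^'d \<Rightarrow> real^'q" assume "1 \<le> p \<and> p < \<infinity> \<and> f \<in> Lp_space p ?L"
    then have p: "1 \<le> p" "p \<noteq> \<infinity>" and f: "f \<in> Lp_space p ?L" by auto
    define P where "P = enn2real p"
    have P: "P \<ge> 1" unfolding P_def using p by (rule enn2real_ge_1)
    have fin: "(\<integral>\<^sup>+x. ennreal (norm (f x) powr P) \<partial>?L) < \<infinity>"
      using f Lp_norm_less_top_iff[OF p(2), of ?L f] by (simp add: Lp_space_def P_def)
    have fL: "f \<in> borel_measurable ?L" using f by (simp add: Lp_space_def)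
    have DL: "D \<in> sets borel" using D by simp
    have small: "\<forall>\<^sub>F \<delta> in at 0 within {0..\<delta>0}.
        (\<integral>\<^sup>+ x. ennreal (norm (?K \<delta> f x - f x) powr P) \<partial>?L) \<le> ennreal E" if "E > 0" for E
    proof -
      \<comment> \<open>The bound of \<open>T_minus_powr_le\<close> rearranges to
        \<open>M * e\<close> plus \<open>2 powr P * 2 powr P * V\<close> times a power with base
        \<open>c * \<epsilon> + a * \<delta> * G\<close>. The choice of \<open>e\<close> makes the
        first term at most \<open>E / 2\<close>; a base of at most \<open>s\<close> does the same
        for the second, and \<epsilon> keeps \<open>c * \<epsilon>\<close> below
        \<open>s / 2\<close>. The bound \<open>G\<close> depends on \<open>e\<close>, but it is
        fixed before \<delta>, so small \<delta> handles the other half of \<open>s\<close>. The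
        added ones avoid division by 0.\<close>
      define M where "M = 2 powr P * (c powr P * B + 2 powr P)"
      define V where "V = measure lborel D"
      have "M \<ge> 0" "V \<ge> 0" using \<open>B \<ge> 0\<close> by (simp_all add: M_def V_def)
      define e where "e = E / (2 * (M + 1))"
      have "e > 0" using \<open>E > 0\<close> \<open>M \<ge> 0\<close> by (simp add: e_def)
      define K where "K = 2 powr P * 2 powr P * (V + 1)"
      have "K > 0" using \<open>V \<ge> 0\<close> by (simp add: K_def add_nonneg_pos)
      define s where "s = (E / (2 * K)) powr (1 / P)"
      have "s > 0" using \<open>E > 0\<close> \<open>K > 0\<close> by (simp add: s_def)
      have sP: "s powr P = E / (2 * K)"
        using P \<open>E > 0\<close> \<open>K > 0\<close> by (simp add: s_def powr_powr)
      define \<epsilon> where "\<epsilon> = s / (2 * (c + 1))"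
      have "\<epsilon> > 0" using \<open>s > 0\<close> \<open>c \<ge> 0\<close> by (simp add: \<epsilon>_def)
      obtain g G where g: "continuous_on UNIV g" "\<And>x. norm (g x) \<le> G"
        and fg: "(\<integral>\<^sup>+x. ennreal (norm (f x - g x) powr P) \<partial>?L) \<le> ennreal e"
        using Lp_approx_bounded_continuous[OF DL D(2) fL P fin \<open>e > 0\<close>] by blast
      have "compact (closure D)" using D by simp
      \<comment> \<open>A point of \<open>D\<close> and its image under
        \<open>?\<Phi> \<delta>\<close> both lie in the compact closure, where \<open>g\<close> is
        uniformly continuous.\<close>
      have "continuous_on (closure D) g"
        using g(1) by (rule continuous_on_subset) simp
      then have "uniformly_continuous_on (closure D) g"
        using \<open>compact (closure D)\<close> by (rule compact_uniformly_continuous)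
      from this[unfolded uniformly_continuous_on_def, rule_format, OF \<open>\<epsilon> > 0\<close>]
      obtain d where "d > 0" and d: "\<And>x z. x \<in> closure D \<Longrightarrow> z \<in> closure D \<Longrightarrow> dist z x < d \<Longrightarrow> dist (g z) (g x) < \<epsilon>"
        by blast
      have "continuous_on (closure D) j"
        using j_cont by (rule continuous_on_subset) simp
      then have "bounded (j ` closure D)"
        using \<open>compact (closure D)\<close> by (intro compact_imp_bounded compact_continuous_image)
      then obtain J where J: "\<And>x. x \<in> D \<Longrightarrow> norm (j x) \<le> J"
        using closure_subset unfolding bounded_iff by blast
      \<comment> \<open>This bounds the displacement of points of \<open>D\<close> under
        \<open>?\<Phi> \<delta>\<close>: \<open>\<delta> * J\<close> from the vector field and
        \<open>\<delta> * r\<close> from the ball.\<close>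
      have "((\<lambda>\<delta>. \<delta> * (J + r)) \<longlongrightarrow> 0) (at 0 within {0..\<delta>0})"
        by (rule tendsto_eq_intros refl tendsto_ident_at | simp)+
      then have ev1: "\<forall>\<^sub>F \<delta> in at 0 within {0..\<delta>0}. \<delta> * (J + r) < d"
        using \<open>d > 0\<close> by (rule order_tendstoD)
      have "((\<lambda>\<delta>. a * \<delta> * G) \<longlongrightarrow> 0) (at 0 within {0..\<delta>0})"
        by (rule tendsto_eq_intros refl tendsto_ident_at | simp)+
      then have ev2: "\<forall>\<^sub>F \<delta> in at 0 within {0..\<delta>0}. a * \<delta> * G < s / 2"
        using \<open>s > 0\<close> by (intro order_tendstoD) auto
      have "\<forall>\<^sub>F \<delta> in at 0 within {0..\<delta>0}. \<delta> \<in> {0..\<delta>0}"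
        by (simp add: eventually_at_filter)
      with ev1 ev2 show ?thesis
      proof eventually_elim
        case (elim \<delta>)
        interpret averaging_operator "density lborel (mollifier \<eta>)" D "ball 0 1" "?\<Phi> \<delta>" B "A \<delta>" c "?K \<delta>"
          by (rule op[OF elim(3)])
        have osc: "norm (g (?\<Phi> \<delta> x y) - g x) \<le> \<epsilon>" if "x \<in> D" "y \<in> ball 0 1" for x y
        proof -
          have "\<delta> \<ge> 0" using elim(3) by simp
          have "?\<Phi> \<delta> x y - x = (\<delta> * r) *\<^sub>R y - \<delta> *\<^sub>R j x"
            by (simp add: shrink_def)
          then have "norm (?\<Phi> \<delta> x y - x) \<le> norm ((\<delta> * r) *\<^sub>R y) + norm (\<delta> *\<^sub>R j x)"
            by (simp only: norm_triangle_ineq4)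
          also have "\<dots> \<le> \<delta> * r * 1 + \<delta> * J"
          proof (rule add_mono)
            show "norm ((\<delta> * r) *\<^sub>R y) \<le> \<delta> * r * 1"
              unfolding norm_scaleR using \<open>\<delta> \<ge> 0\<close> assms(8) \<open>y \<in> ball 0 1\<close>
              by (intro mult_mono) auto
            show "norm (\<delta> *\<^sub>R j x) \<le> \<delta> * J"
              unfolding norm_scaleR using \<open>\<delta> \<ge> 0\<close> J[OF \<open>x \<in> D\<close>]
              by (intro mult_mono) auto
          qed
          also have "\<dots> < d" using elim(1) by (simp add: distrib_left add.commute)
          finally have "dist (?\<Phi> \<delta> x y) x < d" by (simp add: dist_norm)
          then have "dist (g (?\<Phi> \<delta> x y)) (g x) < \<epsilon>"
            using maps[OF that] \<open>x \<in> D\<close> closure_subset by (intro d) auto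
          then show ?thesis by (simp add: dist_norm)
        qed
        have "(\<integral>\<^sup>+ x. ennreal (norm (?K \<delta> f x - f x) powr P) \<partial>?L) \<le>
          ennreal (2 powr P * (c powr P * B * e + 2 powr P * ((c * \<epsilon> + a * \<delta> * G) powr P * V + e)))"
          unfolding P_def V_def
          using fg \<open>\<epsilon> > 0\<close> \<open>e > 0\<close> elim(3)
          by (intro T_minus_powr_le[OF f p g osc _ A_near[OF elim(3)]]) (auto simp: P_def a_def)
        also have "\<dots> \<le> ennreal E"
        proof (rule ennreal_leI)
          have "G \<ge> 0" using g(2) norm_ge_zero order_trans by blast
          have "c * \<epsilon> \<le> s / 2"
            using \<open>c \<ge> 0\<close> \<open>s > 0\<close> by (simp add: \<epsilon>_def field_simps)
          then have "(c * \<epsilon> + a * \<delta> * G) powr P \<le> s powr P"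
            using elim P \<open>c \<ge> 0\<close> \<open>\<epsilon> > 0\<close> \<open>G \<ge> 0\<close> by (intro powr_mono2) (auto simp: a_def)
          then have "(c * \<epsilon> + a * \<delta> * G) powr P * V \<le> s powr P * (V + 1)"
            using \<open>V \<ge> 0\<close> by (intro mult_mono) auto
          then have "2 powr P * 2 powr P * ((c * \<epsilon> + a * \<delta> * G) powr P * V) \<le> 2 powr P * 2 powr P * (s powr P * (V + 1))"
            by (intro mult_left_mono) auto
          also have "\<dots> = K * s powr P" by (simp add: K_def)
          also have "\<dots> = E / 2" using \<open>K > 0\<close> by (simp add: sP)
          finally have 1: "2 powr P * 2 powr P * ((c * \<epsilon> + a * \<delta> * G) powr P * V) \<le> E / 2" .
          have 2: "M * e \<le> E / 2"
            using \<open>M \<ge> 0\<close> \<open>E > 0\<close> by (simp add: e_def field_simps)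
          have "2 powr P * (c powr P * B * e + 2 powr P * ((c * \<epsilon> + a * \<delta> * G) powr P * V + e))
            = M * e + 2 powr P * 2 powr P * ((c * \<epsilon> + a * \<delta> * G) powr P * V)"
            unfolding M_def by (simp only: distrib_left distrib_right mult_ac add_ac)
          then show "2 powr P * (c powr P * B * e + 2 powr P * ((c * \<epsilon> + a * \<delta> * G) powr P * V + e)) \<le> E"
            using 1 2 by linarith
        qed
        finally show ?case .
      qed
    qed
    show "((\<lambda>\<delta>. Lp_norm p ?L (\<lambda>x. ?K \<delta> f x - f x)) \<longlongrightarrow> 0) (at 0 within {0..\<delta>0})"
    proof (rule order_tendstoI)
      fix b :: ennreal assume "0 < b"
      \<comment> \<open>The level \<open>b\<close> may be infinite; a finite \<open>u\<close> in
        between corresponds to a real \<open>t\<close>, and \<open>small\<close> is used with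
        \<open>t powr P\<close>.\<close>
      then obtain u where u: "0 < u" "u < b" using dense by blast
      then have "u < \<infinity>" using le_less_trans[of u b] by (metis infinity_ennreal_def less_top not_less_iff_gr_or_eq order_less_le_trans top_greatest)
      define t where "t = enn2real u"
      have t: "t > 0" "ennreal t = u"
        using u \<open>u < \<infinity>\<close> by (auto simp: t_def enn2real_positive_iff)
      have "\<forall>\<^sub>F \<delta> in at 0 within {0..\<delta>0}.
          (\<integral>\<^sup>+ x. ennreal (norm (?K \<delta> f x - f x) powr P) \<partial>?L) \<le> ennreal (t powr P)"
        using t by (intro small) simp
      then show "\<forall>\<^sub>F \<delta> in at 0 within {0..\<delta>0}. Lp_norm p ?L (\<lambda>x. ?K \<delta> f x - f x) < b"
      proof eventually_elim
        case (elim \<delta>)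
        then have "Lp_norm p ?L (\<lambda>x. ?K \<delta> f x - f x) \<le> ennreal ((t powr P) powr (1 / P))"
          unfolding P_def by (intro Lp_norm_le p) auto
        also have "(t powr P) powr (1 / P) = t"
          using t P by (simp add: powr_powr)
        finally show ?case using t u by simp
      qed
    qed simp
  qed
qed

end
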